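(* Let $n\in\mathbb{N}$ and let $\mathfrak{N}$ be the class of non-degenerate ReLU networks with integer weights and biases, with $n$ input nodes, realizing functions $f:[0,1]^n\to[0,1]$. For every $\mathcal{N}\in\mathfrak{N}$, $\mathrm{constr}(\mathrm{ext}(\mathcal{N}))=\mathcal{N}$.
   Context: **Layered graphs and networks.** A layered graph of depth $L\ge1$ and architecture $(d_0,\dots,d_L)$, $d_L=1$, $d_j\ge 1$, has nodes partitioned into levels $V^{(j)}=\{v^{(j)}_1,\dots,v^{(j)}_{d_j}\}$, $j=0,\dots,L$, $V^{(L)}=\{v_{\rm out}\}$, with edges exactly all pairs (node of level $j-1$, node of level $j$), $j=1,\dots,L$. A neural network is a layered graph with a weight $w_{v,u}\in\mathbb{R}$ on each edge $(u,v)$ (possibly zero), a bias $b_v$ at each non-input node, and activation functions. $V^{(0)}$ are input nodes; nodes at levels $1,\dots,L-1$ are hidden. In a ReLU network ($\rho$-network) all hidden nodes have activation $\rho(t)=\max\{t,0\}$ and the output node has none; in a $\sigma$-network all non-input nodes (output included) have activation $\sigma(t)=\max\{\min\{t,1\},0\}$. The local map $\langle v\rangle$ of a node at level $j\ge 1$ is $x\mapsto\psi_v(\sum_{i'}w_{v,v^{(j-1)}_{i'}}x_{i'}+b_v)$, $x\in\mathbb{R}^{d_{j-1}}$ ($\psi_v$ the activation, or identity if none), and $\langle v_i^{(0)}\rangle(x)=x_i$. The global map $\langle\!\langle v\rangle\!\rangle:\mathbb{R}^{d_0}\to\mathbb{R}$ is obtained by composing local maps from the inputs on, and $\langle\mathcal{N}\rangle=\langle\!\langle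 v_{\rm out}\rangle\!\rangle$. "Realizing a function $[0,1]^n\to[0,1]$" means $d_0=n$ and $\langle\mathcal N\rangle([0,1]^n)\subseteq[0,1]$. Networks differing only in the naming/enumeration of their hidden nodes are identified. **Non-degenerate.** A ReLU network is non-degenerate (on $[0,1]^{d_0}$) if: every hidden node $v$ satisfies $\langle\!\langle v\rangle\!\rangle(x)>0$ for some $x\in[0,1]^{d_0}$; every hidden node satisfies $\langle\!\langle v\rangle\!\rangle(x)=0$ for some $x\in[0,1]^{d_0}$; no two nodes at the same level have the same local map; every hidden node has at least one nonzero outgoing weight. **Formulae.** A Łukasiewicz formula is a finite string built from variables $x_1,x_2,\dots$ and constants $0,1$ with binary $\oplus,\odot$ and unary $\lnot$; its truth function $\tau^{\mathbb{I}}$ is obtained by evaluating on $[0,1]$ with $x\oplus y=\min\{1,x+y\}$, $x\odot y=\max\{0,x+y-1\}$, $\lnot x=1-x$. For $f=m_1x_1+\dots+m_nx_n+b$ with integer coefficients, with min $\ell$ and max $\mathcal{L}$ over $[0,1]^n$, the formula $\mathtt{EXTR}(\sigma(f))$ is: $1$ if $\ell\ge1$; $0$ if $\mathcal{L}\le0$; otherwise let $k$ be the smallest index with $m_k\ne0$; if $m_k\ge1$ it is $(\mathtt{EXTR}(\sigma(f-x_k))\oplus x_k)\odot\mathtt{EXTR}(\sigma(f-x_k+1))$; if $m_k\le-1$ it is $\lnot\,\mathtt{EXTR}(\sigma(1-f))$; occurrences $0\oplus\tau$ and $\tau\odot1$ produced by the recursion are simplified to $\tau$. Formulae of the form $\mathtt{EXTR}(\sigma(f))$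 are called minterms. **Substitution graphs.** A substitution graph is a layered graph with a formula $[v]$ at each node: $[v_i^{(0)}]=x_i$, and a node at level $j\ge1$ carries a formula in the variables $x_1,\dots,x_{d_{j-1}}$, $x_{i'}$ referring to the parent $v^{(j-1)}_{i'}$. It is normal if all node formulae are minterms. **Extraction** $\mathrm{ext}(\mathcal{N})$, for a ReLU network $\mathcal N$ with integer weights and biases, $[0,1]$-valued on $[0,1]^{d_0}$. *Step I.* For $j=1,\dots,L-1$ in this order, for each node $v$ of level $j$ compute $\mathcal{L}_v=b_v+\sum_u\max\{w_{v,u},0\}$ over its (already converted) parents $u$. If $\mathcal{L}_v\le1$, replace its activation by $\sigma$; if $\mathcal{L}_v>1$, replace $v$ by $\lceil\mathcal{L}_v\rceil$ $\sigma$-nodes with the same incoming and outgoing weights and biases $b_v,b_v-1,\dots,b_v-\lceil\mathcal{L}_v\rceil+1$. Finally apply $\sigma$ at the output node. *Step II.* Each input node gets $x_i$; each non-input node with local map $\sigma(f)$ gets $\mathtt{EXTR}(\sigma(f))$. $\mathrm{ext}(\mathcal N)$ is the layered graph of the $\sigma$-network from Step I with these node formulae (it is normal). **Construction** $\mathrm{constr}(\mathcal{G})$, for a normal substitution graph $\mathcal{G}$. *Step I.* Build a $\sigma$-network on the layered graph of $\mathcal{G}$: for a non-input node $v$ with parents $v^{(j-1)}_{i'}$, if $[v]^{\mathbb{I}}$ is non-constant on $[0,1]^{d_{j-1}}$ there are unique integers $m_{i'},b$ with $[v]^{\mathbb{I}}=\sigma(b+\sum_{i'}m_{i'}x_{i'})$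 there, and $v$ gets incoming weights $m_{i'}$ and bias $b$; if $[v]^{\mathbb{I}}$ is constant, equal to $c\in\{0,1\}$, $v$ gets zero incoming weights and bias $c$. *Step II.* Process hidden levels $j=L-1,\dots,1$ in this order. For each node $v$ of level $j$, with $\mathcal{L}_v=b_v+\sum_u\max\{w_{v,u},0\}$ over its parents: if $\mathcal{L}_v\le1$, change its activation to $\rho$; if $\mathcal{L}_v>1$, change its activation to $\rho$ and add to level $j$ a companion $\rho$-node with the same incoming weights, negated outgoing weights and bias $b_v-1$. Then aggregate level $j$: merge nodes with equal local map into one node, adding their outgoing weights, and remove every node of the level whose outgoing weights are then all zero. Finally, at the output node, let $g$ be its pre-activation as a function of the network input: if $0\le g\le1$ on $[0,1]^{d_0}$, drop the activation $\sigma$; otherwise turn $v_{\rm out}$ and a companion with the same incoming weights and bias $b_{v_{\rm out}}-1$ into hidden $\rho$-nodes feeding a new output node with weights $1$ and $-1$ and bias $0$. *)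

theory Defs
  imports Complex_Main
begin

text \<open>
  Nodes of a level, coordinates of a vector and variables of a formula are numbered from \<open>0\<close>.
  A vector of length \<open>d\<close> is a function \<open>nat \<Rightarrow> real\<close> of which only the values at \<open>i < d\<close> are ever
  used; so two local maps are equal as functions on \<open>nat \<Rightarrow> real\<close> iff they are equal on
  \<open>d\<close>-dimensional space.
\<close>

definition unit_cube :: "nat \<Rightarrow> (nat \<Rightarrow> real) set" where
  "unit_cube n = {x. \<forall>i<n. 0 \<le> x i \<and> x i \<le> 1}"

definition aff :: "real list \<Rightarrow> real \<Rightarrow> (nat \<Rightarrow> real) \<Rightarrow> real" where
  "aff ws b x = (\<Sum>i<length ws. ws ! i * x i) + b"

definition relu :: "real \<Rightarrow> real" where
  "relu t = max t 0"

definition clipped_relu :: "real \<Rightarrow> real" where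
  "clipped_relu t = max (min t 1) 0"


section \<open>Layered networks\<close>

datatype activation = Relu | Sigma | Ident

fun activate :: "activation \<Rightarrow> real \<Rightarrow> real" where
  "activate Relu t = relu t"
| "activate Sigma t = clipped_relu t"
| "activate Ident t = t"

record neuron =
  weights :: "real list"
  bias :: real
  act :: activation

text \<open>
  \<open>layers\<close> lists the levels \<open>1, \<dots>, L\<close>; level \<open>0\<close> is given by its number of nodes only. The
  \<open>i\<close>-th entry of \<open>weights v\<close> belongs to the edge from the \<open>i\<close>-th node of the preceding level.
\<close>

record network =
  inputs :: nat
  layers :: "neuron list list"

definition architecture :: "nat list \<Rightarrow> bool" where
  "architecture ds \<longleftrightarrow> length ds \<ge> 2 \<and> (\<forall>d\<in>set ds. d \<ge> 1) \<and> last ds = 1"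

definition depth :: "network \<Rightarrow> nat" where
  "depth N = length (layers N)"

definition widths :: "network \<Rightarrow> nat list" where
  "widths N = inputs N # map length (layers N)"

definition width :: "network \<Rightarrow> nat \<Rightarrow> nat" where
  "width N j = widths N ! j"

definition node :: "network \<Rightarrow> nat \<Rightarrow> nat \<Rightarrow> neuron" where
  "node N j i = layers N ! (j - 1) ! i"

definition layered :: "network \<Rightarrow> bool" where
  "layered N \<longleftrightarrow> architecture (widths N) \<and>
     (\<forall>j\<in>{1..depth N}. \<forall>i<width N j. length (weights (node N j i)) = width N (j - 1))"

definition neuron_map :: "neuron \<Rightarrow> (nat \<Rightarrow> real) \<Rightarrow> real" where
  "neuron_map v x = activate (act v) (aff (weights v) (bias v) x)"

definition local_map :: "network \<Rightarrow> nat \<Rightarrow> nat \<Rightarrow> (nat \<Rightarrow> real) \<Rightarrow> real" where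
  "local_map N j i = (if j = 0 then (\<lambda>x. x i) else neuron_map (node N j i))"

fun feed :: "neuron list list \<Rightarrow> (nat \<Rightarrow> real) \<Rightarrow> nat \<Rightarrow> real" where
  "feed [] x = x"
| "feed (l # ls) x = feed ls (\<lambda>i. if i < length l then neuron_map (l ! i) x else 0)"

definition global_map :: "network \<Rightarrow> nat \<Rightarrow> nat \<Rightarrow> (nat \<Rightarrow> real) \<Rightarrow> real" where
  "global_map N j i x = feed (take j (layers N)) x i"

definition realization :: "network \<Rightarrow> (nat \<Rightarrow> real) \<Rightarrow> real" where
  "realization N = global_map N (depth N) 0"

definition relu_network :: "network \<Rightarrow> bool" where
  "relu_network N \<longleftrightarrow> layered N \<and>
     (\<forall>j\<in>{1..<depth N}. \<forall>i<width N j. act (node N j i) = Relu) \<and>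
     act (node N (depth N) 0) = Ident"

definition integer_network :: "network \<Rightarrow> bool" where
  "integer_network N \<longleftrightarrow> (\<forall>j\<in>{1..depth N}. \<forall>i<width N j.
     set (weights (node N j i)) \<subseteq> \<int> \<and> bias (node N j i) \<in> \<int>)"

definition nondegenerate :: "network \<Rightarrow> bool" where
  "nondegenerate N \<longleftrightarrow>
     (\<forall>j\<in>{1..<depth N}. \<forall>i<width N j. \<exists>x\<in>unit_cube (inputs N). global_map N j i x > 0) \<and>
     (\<forall>j\<in>{1..<depth N}. \<forall>i<width N j. \<exists>x\<in>unit_cube (inputs N). global_map N j i x = 0) \<and>
     (\<forall>j\<in>{0..depth N}. \<forall>i<width N j. \<forall>i'<width N j.
        i \<noteq> i' \<longrightarrow> local_map N j i \<noteq> local_map N j i') \<and>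
     (\<forall>j\<in>{1..<depth N}. \<forall>i<width N j. \<exists>k<width N (j + 1).
        weights (node N (j + 1) k) ! i \<noteq> 0)"

definition nondegenerate_class :: "nat \<Rightarrow> network set" where
  "nondegenerate_class n = {N. relu_network N \<and> integer_network N \<and> nondegenerate N \<and>
     inputs N = n \<and> realization N ` unit_cube n \<subseteq> {0..1}}"

text \<open>
  Equality of networks up to the enumeration of their hidden nodes: the nodes of level \<open>j\<close> are
  matched by the bijection \<open>\<pi> j\<close>, which fixes the input and output nodes.
\<close>

definition same_network :: "network \<Rightarrow> network \<Rightarrow> bool" where
  "same_network N N' \<longleftrightarrow> inputs N = inputs N' \<and> depth N = depth N' \<and>
     (\<exists>\<pi> :: nat \<Rightarrow> nat \<Rightarrow> nat.
        (\<forall>j\<le>depth N. bij_betw (\<pi> j) {..<width N j} {..<width N' j}) \<and>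
        (\<forall>j\<in>{0, depth N}. \<forall>i<width N j. \<pi> j i = i) \<and>
        (\<forall>j\<in>{1..depth N}. \<forall>i<width N j.
           (let v = node N j i; v' = node N' j (\<pi> j i) in
              act v' = act v \<and> bias v' = bias v \<and>
              length (weights v) = width N (j - 1) \<and>
              length (weights v') = width N' (j - 1) \<and>
              (\<forall>i'<width N (j - 1). weights v' ! \<pi> (j - 1) i' = weights v ! i'))))"


section \<open>Formulae and minterms\<close>

datatype formula =
    Var nat
  | FZero
  | FOne
  | Oplus formula formula
  | Odot formula formula
  | Neg formula

fun truth :: "formula \<Rightarrow> (nat \<Rightarrow> real) \<Rightarrow> real" where
  "truth (Var i) x = x i"
| "truth FZero x = 0"
| "truth FOne x = 1"
| "truth (Oplus \<phi> \<psi>) x = min 1 (truth \<phi> x + truth \<psi> x)"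
| "truth (Odot \<phi> \<psi>) x = max 0 (truth \<phi> x + truth \<psi> x - 1)"
| "truth (Neg \<phi>) x = 1 - truth \<phi> x"

definition int_aff :: "int list \<Rightarrow> int \<Rightarrow> (nat \<Rightarrow> real) \<Rightarrow> real" where
  "int_aff m b = aff (map real_of_int m) (real_of_int b)"

definition cube_min :: "int list \<Rightarrow> int \<Rightarrow> real" where
  "cube_min m b = (INF x\<in>unit_cube (length m). int_aff m b x)"

definition cube_max :: "int list \<Rightarrow> int \<Rightarrow> real" where
  "cube_max m b = (SUP x\<in>unit_cube (length m). int_aff m b x)"

lemma int_aff_eq: "int_aff m b x = (\<Sum>i<length m. of_int (m ! i) * x i) + of_int b"
  by (simp add: int_aff_def aff_def)

lemma cube_min_eq: "cube_min m b = of_int ((\<Sum>i<length m. min (m ! i) 0) + b)"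
  unfolding cube_min_def
proof (rule cInf_eq_minimum)
  let ?x = "\<lambda>i. if m ! i < 0 then 1 else (0::real)"
  have "int_aff m b ?x = of_int ((\<Sum>i<length m. min (m ! i) 0) + b)"
    unfolding int_aff_eq by (auto intro!: sum.cong)
  moreover have "?x \<in> unit_cube (length m)"
    by (auto simp: unit_cube_def)
  ultimately show "of_int ((\<Sum>i<length m. min (m ! i) 0) + b) \<in> int_aff m b ` unit_cube (length m)"
    by (metis imageI)
next
  fix y assume "y \<in> int_aff m b ` unit_cube (length m)"
  then obtain x where x: "x \<in> unit_cube (length m)" and y: "y = int_aff m b x"
    by blast
  have "of_int (min (m ! i) 0) \<le> of_int (m ! i) * x i" if "i < length m" for i
  proof (cases "m ! i < 0")
    case True
    then show ?thesis
      using x that by (auto simp: unit_cube_def intro!: mult_right_le_one_le mult_left_mono_neg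
          [of "x i" 1, simplified])
  next
    case False
    then show ?thesis
      using x that by (auto simp: unit_cube_def)
  qed
  then have "(\<Sum>i<length m. of_int (min (m ! i) 0)) \<le> (\<Sum>i<length m. of_int (m ! i) * x i)"
    by (intro sum_mono) auto
  then show "of_int ((\<Sum>i<length m. min (m ! i) 0) + b) \<le> y"
    unfolding y int_aff_eq of_int_add of_int_sum by simp
qed

lemma cube_max_eq: "cube_max m b = of_int ((\<Sum>i<length m. max (m ! i) 0) + b)"
  unfolding cube_max_def
proof (rule cSup_eq_maximum)
  let ?x = "\<lambda>i. if m ! i > 0 then 1 else (0::real)"
  have "int_aff m b ?x = of_int ((\<Sum>i<length m. max (m ! i) 0) + b)"
    unfolding int_aff_eq by (auto intro!: sum.cong)
  moreover have "?x \<in> unit_cube (length m)"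
    by (auto simp: unit_cube_def)
  ultimately show "of_int ((\<Sum>i<length m. max (m ! i) 0) + b) \<in> int_aff m b ` unit_cube (length m)"
    by (metis imageI)
next
  fix y assume "y \<in> int_aff m b ` unit_cube (length m)"
  then obtain x where x: "x \<in> unit_cube (length m)" and y: "y = int_aff m b x"
    by blast
  have "of_int (m ! i) * x i \<le> of_int (max (m ! i) 0)" if "i < length m" for i
  proof (cases "m ! i > 0")
    case True
    then show ?thesis
      using x that by (auto simp: unit_cube_def intro!: mult_left_le)
  next
    case False
    then show ?thesis
      using x that by (auto simp: unit_cube_def intro!: mult_nonpos_nonneg)
  qed
  then have "(\<Sum>i<length m. of_int (m ! i) * x i) \<le> (\<Sum>i<length m. of_int (max (m ! i) 0))"
    by (intro sum_mono) auto
  then show "y \<le> of_int ((\<Sum>i<length m. max (m ! i) 0) + b)"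
    unfolding y int_aff_eq of_int_add of_int_sum by simp
qed

definition lead_index :: "int list \<Rightarrow> nat" where
  "lead_index m = (LEAST k. k < length m \<and> m ! k \<noteq> 0)"

lemma lead_index:
  assumes "\<not> cube_min m b \<ge> 1" "\<not> cube_max m b \<le> 0"
  shows "lead_index m < length m" "m ! lead_index m \<noteq> 0"
proof -
  have "\<exists>k. k < length m \<and> m ! k \<noteq> 0"
  proof (rule ccontr)
    assume "\<not> ?thesis"
    then have "cube_min m b = of_int b" "cube_max m b = of_int b"
      by (auto simp: cube_min_eq cube_max_eq)
    with assms show False by simp
  qed
  from LeastI_ex[OF this] show "lead_index m < length m" "m ! lead_index m \<noteq> 0"
    by (auto simp: lead_index_def)
qed

lemma lead_index_uminus: "lead_index (map uminus m) = lead_index m"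
proof -
  have "(k < length (map uminus m) \<and> map uminus m ! k \<noteq> 0) = (k < length m \<and> m ! k \<noteq> 0)" for k
    by auto
  then show ?thesis
    by (simp add: lead_index_def)
qed

lemma sum_abs_decrease:
  fixes m :: "int list"
  assumes "k < length m" "m ! k \<ge> 1"
  shows "nat (\<Sum>i<length m. \<bar>m[k := m ! k - 1] ! i\<bar>) < nat (\<Sum>i<length m. \<bar>m ! i\<bar>)"
proof -
  have "(\<Sum>i<length m. \<bar>m[k := m ! k - 1] ! i\<bar>) < (\<Sum>i<length m. \<bar>m ! i\<bar>)"
    using assms by (intro sum_strict_mono_ex1) (auto simp: nth_list_update)
  moreover have "0 \<le> (\<Sum>i<length m. \<bar>m[k := m ! k - 1] ! i\<bar>)"
    by (intro sum_nonneg) auto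
  ultimately show ?thesis
    by linarith
qed

fun oplus_simp :: "formula \<Rightarrow> formula \<Rightarrow> formula" where
  "oplus_simp \<phi> \<psi> = (if \<phi> = FZero then \<psi> else Oplus \<phi> \<psi>)"

fun odot_simp :: "formula \<Rightarrow> formula \<Rightarrow> formula" where
  "odot_simp \<phi> \<psi> = (if \<psi> = FOne then \<phi> else Odot \<phi> \<psi>)"

text \<open>
  \<open>EXTR m b\<close> is the formula extracted from \<open>\<sigma>(m\<^sub>1x\<^sub>1 + \<dots> + m\<^sub>nx\<^sub>n + b)\<close>. When neither of the
  first two cases applies, some coefficient is nonzero (fact \<open>lead_index\<close>).
\<close>

function EXTR :: "int list \<Rightarrow> int \<Rightarrow> formula" where
  "EXTR m b =
     (if cube_min m b \<ge> 1 then FOne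
      else if cube_max m b \<le> 0 then FZero
      else let k = lead_index m in
        if m ! k \<ge> 1
        then odot_simp (oplus_simp (EXTR (m[k := m ! k - 1]) b) (Var k))
               (EXTR (m[k := m ! k - 1]) (b + 1))
        else Neg (EXTR (map uminus m) (1 - b)))"
  by pat_completeness auto
termination
proof (relation "measure (\<lambda>(m, b). 2 * nat (\<Sum>i<length m. \<bar>m ! i\<bar>) +
    (if m ! lead_index m < 0 then 1 else 0))", goal_cases)
  case 1
  then show ?case by simp
next
  case (2 m b k)
  then have "k < length m" "m ! k \<ge> 1"
    using lead_index[of m b] by auto
  from sum_abs_decrease[OF this] show ?case
    using 2 by auto
next
  case (3 m b k)
  then have "k < length m" "m ! k \<ge> 1"
    using lead_index[of m b] by auto
  from sum_abs_decrease[OF this] show ?case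
    using 3 by auto
next
  case (4 m b k)
  then have "lead_index m < length m" "m ! lead_index m < 0"
    using lead_index[of m b] by auto
  then show ?case
    by (simp add: lead_index_uminus)
qed

declare EXTR.simps [simp del]

definition minterm :: "nat \<Rightarrow> formula \<Rightarrow> bool" where
  "minterm n \<phi> \<longleftrightarrow> (\<exists>m b. length m = n \<and> \<phi> = EXTR m b)"


section \<open>Substitution graphs\<close>

text \<open>
  \<open>formulae\<close> lists the node formulae of the levels \<open>1, \<dots>, L\<close>; the input nodes carry
  \<open>Var 0, \<dots>, Var (variables - 1)\<close>.
\<close>

record subst_graph =
  variables :: nat
  formulae :: "formula list list"

definition normal_graph :: "subst_graph \<Rightarrow> bool" where
  "normal_graph G \<longleftrightarrow> (let ds = variables G # map length (formulae G) in
     architecture ds \<and>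
     (\<forall>j<length (formulae G). \<forall>\<phi>\<in>set (formulae G ! j). minterm (ds ! j) \<phi>))"


section \<open>Extraction\<close>

definition upper :: "neuron \<Rightarrow> real" where
  "upper v = bias v + (\<Sum>w\<leftarrow>weights v. max w 0)"

definition sigma_copies :: "neuron \<Rightarrow> neuron list" where
  "sigma_copies v =
     (if upper v \<le> 1 then [v\<lparr>act := Sigma\<rparr>]
      else map (\<lambda>k. v\<lparr>bias := bias v - real k, act := Sigma\<rparr>) [0..<nat \<lceil>upper v\<rceil>])"

text \<open>
  Replacing the \<open>i\<close>-th parent by \<open>cs ! i\<close> copies with the same outgoing weights.
\<close>

definition expand_weights :: "nat list \<Rightarrow> neuron \<Rightarrow> neuron" where
  "expand_weights cs v = v\<lparr>weights := concat (map2 replicate cs (weights v))\<rparr>"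

text \<open>
  In \<open>sigma_layers cs ls\<close> the list \<open>cs\<close> records by how many copies each node of the level below
  \<open>ls\<close> has been replaced.
\<close>

fun sigma_layers :: "nat list \<Rightarrow> neuron list list \<Rightarrow> neuron list list" where
  "sigma_layers cs [] = []"
| "sigma_layers cs [l] = [map (\<lambda>v. (expand_weights cs v)\<lparr>act := Sigma\<rparr>) l]"
| "sigma_layers cs (l # l' # ls) =
     (let copies = map (\<lambda>v. sigma_copies (expand_weights cs v)) l
      in concat copies # sigma_layers (map length copies) (l' # ls))"

text \<open>The floors only convert integer-valued reals to integers.\<close>

definition node_formula :: "neuron \<Rightarrow> formula" where
  "node_formula v = EXTR (map floor (weights v)) \<lfloor>bias v\<rfloor>"

definition ext :: "network \<Rightarrow> subst_graph" where
  "ext N = \<lparr>variables = inputs N,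
     formulae = map (map node_formula) (sigma_layers (replicate (inputs N) 1) (layers N))\<rparr>"


lemma length_expand_weights:
  assumes "length cs = length (weights v)"
  shows "length (weights (expand_weights cs v)) = sum_list cs"
proof -
  have "length (concat (map2 replicate cs ws)) = sum_list cs" if "length cs = length ws" for ws :: "real list"
    using that by (induction cs ws rule: list_induct2) auto
  with assms show ?thesis
    by (simp add: expand_weights_def)
qed

lemma sigma_copies_weights: "u \<in> set (sigma_copies v) \<Longrightarrow> weights u = weights v"
  by (auto simp: sigma_copies_def split: if_splits)

lemma length_sigma_copies: "length (sigma_copies v) \<ge> 1"
  by (simp add: sigma_copies_def) linarith

text \<open>Extraction yields normal substitution graphs, the domain of the construction.\<close>

lemma sigma_layers_normal:
  assumes "ls \<noteq> []" "length (last ls) = 1" "\<forall>l\<in>set ls. length l \<ge> 1"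
    and "\<forall>j<length ls. \<forall>v\<in>set (ls ! j). length (weights v) = (length cs # map length ls) ! j"
  shows "length (sigma_layers cs ls) = length ls \<and> length (last (sigma_layers cs ls)) = 1 \<and>
    (\<forall>l\<in>set (sigma_layers cs ls). length l \<ge> 1) \<and>
    (\<forall>j<length (sigma_layers cs ls). \<forall>v\<in>set (sigma_layers cs ls ! j).
       length (weights v) = (sum_list cs # map length (sigma_layers cs ls)) ! j)"
  using assms
proof (induction cs ls rule: sigma_layers.induct)
  case (1 cs)
  then show ?case by simp
next
  case (2 cs l)
  then show ?case by (auto simp: length_expand_weights)
next
  case (3 cs l l' ls)
  define copies where "copies = map (\<lambda>v. sigma_copies (expand_weights cs v)) l"
  have w: "length (weights v) = length cs" if "v \<in> set l" for v
    using 3(5) that by (auto dest: spec[of _ 0])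
  have tail: "length (weights v) = (length l # map length (l' # ls)) ! j"
    if "j < length (l' # ls)" "v \<in> set ((l' # ls) ! j)" for j v
    using 3(5)[rule_format, of "Suc j" v] that by simp
  have IH: "length (sigma_layers (map length copies) (l' # ls)) = length (l' # ls) \<and>
    length (last (sigma_layers (map length copies) (l' # ls))) = 1 \<and>
    (\<forall>l\<in>set (sigma_layers (map length copies) (l' # ls)). length l \<ge> 1) \<and>
    (\<forall>j<length (sigma_layers (map length copies) (l' # ls)).
       \<forall>v\<in>set (sigma_layers (map length copies) (l' # ls) ! j). length (weights v) =
       (sum_list (map length copies) # map length (sigma_layers (map length copies) (l' # ls))) ! j)"
    using 3(3,4) tail by (intro 3(1)) (auto simp: copies_def)
  have eq: "sigma_layers cs (l # l' # ls) =
      concat copies # sigma_layers (map length copies) (l' # ls)"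
    by (simp add: copies_def Let_def)
  have ne: "sigma_layers (map length copies) (l' # ls) \<noteq> []"
    using IH by auto
  obtain v where v: "v \<in> set l"
    using 3(4) by (cases l) auto
  have "length (concat copies) \<ge> 1"
  proof -
    have "sigma_copies (expand_weights cs v) \<noteq> []"
      using length_sigma_copies[of "expand_weights cs v"] by auto
    then have "concat copies \<noteq> []"
      using v by (auto simp: copies_def)
    then show ?thesis
      by (simp add: Suc_le_eq)
  qed
  moreover have "length (weights u) = sum_list cs" if "u \<in> set (concat copies)" for u
    using that w by (auto simp: copies_def length_expand_weights dest!: sigma_copies_weights)
  moreover have "length (concat copies) = sum_list (map length copies)"
    by (simp add: length_concat)
  ultimately show ?case
    unfolding eq using IH ne
    by (simp add: nth_Cons split: nat.splits)
qed

lemma normal_ext: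
  assumes "layered N"
  shows "normal_graph (ext N)"
proof -
  define S where "S = sigma_layers (replicate (inputs N) 1) (layers N)"
  have "architecture (inputs N # map length (layers N))"
    using assms by (simp add: layered_def widths_def)
  moreover from this have ne: "layers N \<noteq> []"
    by (auto simp: architecture_def)
  ultimately have arch: "length (last (layers N)) = 1" "\<forall>l\<in>set (layers N). length l \<ge> 1"
    "inputs N \<ge> 1"
    by (simp_all add: architecture_def last_map)
  have "\<forall>j<length (layers N). \<forall>v\<in>set (layers N ! j).
      length (weights v) = (length (replicate (inputs N) (1::nat)) # map length (layers N)) ! j"
  proof (intro allI impI ballI)
    fix j v assume j: "j < length (layers N)" and "v \<in> set (layers N ! j)"
    then obtain i where "i < length (layers N ! j)" "v = layers N ! j ! i"
      by (auto simp: in_set_conv_nth)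
    moreover from this j have "length (weights (node N (Suc j) i)) = width N j"
      using assms unfolding layered_def
      by (metis One_nat_def Suc_leI atLeastAtMost_iff depth_def diff_Suc_1 le_add1 length_map
          node_def nth_Cons_Suc nth_map plus_1_eq_Suc width_def widths_def)
    ultimately show "length (weights v) =
        (length (replicate (inputs N) (1::nat)) # map length (layers N)) ! j"
      by (simp add: node_def width_def widths_def)
  qed
  from sigma_layers_normal[OF ne arch(1,2) this] have S:
    "length S = length (layers N)" "length (last S) = 1" "\<forall>l\<in>set S. length l \<ge> 1"
    "\<forall>j<length S. \<forall>v\<in>set (S ! j). length (weights v) = (inputs N # map length S) ! j"
    unfolding S_def sum_list_replicate by simp_all
  have "S \<noteq> []"
    using S(1) ne by auto
  then have "architecture (inputs N # map length S)"
    using S arch by (auto simp: architecture_def last_map Suc_le_eq)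
  moreover have "minterm ((inputs N # map length S) ! j) \<phi>"
    if "j < length S" "\<phi> \<in> node_formula ` set (S ! j)" for j \<phi>
  proof -
    from that(2) obtain v where v: "v \<in> set (S ! j)" "\<phi> = node_formula v"
      by blast
    with S(4) that(1) have "length (map floor (weights v)) = (inputs N # map length S) ! j"
      by simp
    with v(2) show ?thesis
      unfolding minterm_def node_formula_def by blast
  qed
  moreover have "ext N = \<lparr>variables = inputs N, formulae = map (map node_formula) S\<rparr>"
    by (simp only: ext_def S_def)
  moreover have "length \<circ> map node_formula = length"
    by auto
  ultimately show ?thesis
    by (simp add: normal_graph_def)
qed


section \<open>Construction\<close>

definition sigma_neuron :: "nat \<Rightarrow> formula \<Rightarrow> neuron" where
  "sigma_neuron d \<phi> =
     (if \<exists>c. \<forall>x\<in>unit_cube d. truth \<phi> x = c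
      then \<lparr>weights = replicate d 0, bias = (THE c. \<forall>x\<in>unit_cube d. truth \<phi> x = c), act = Sigma\<rparr>
      else let (m, b) = (THE (m, b). length m = d \<and>
                 (\<forall>x\<in>unit_cube d. truth \<phi> x = clipped_relu (int_aff m b x)))
           in \<lparr>weights = map real_of_int m, bias = real_of_int b, act = Sigma\<rparr>)"

fun read_layers :: "nat \<Rightarrow> formula list list \<Rightarrow> neuron list list" where
  "read_layers d [] = []"
| "read_layers d (l # ls) = map (sigma_neuron d) l # read_layers (length l) ls"

text \<open>
  While a level is processed, each of its nodes is paired with the list of its outgoing weights.
\<close>

type_synonym out_neuron = "neuron \<times> real list"

definition with_outgoing :: "neuron list \<Rightarrow> neuron list \<Rightarrow> out_neuron list" where
  "with_outgoing l next_level =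
     map (\<lambda>i. (l ! i, map (\<lambda>u. weights u ! i) next_level)) [0..<length l]"

fun relu_split :: "out_neuron \<Rightarrow> out_neuron list" where
  "relu_split (v, ws) =
     (if upper v \<le> 1 then [(v\<lparr>act := Relu\<rparr>, ws)]
      else [(v\<lparr>act := Relu\<rparr>, ws), (v\<lparr>bias := bias v - 1, act := Relu\<rparr>, map uminus ws)])"

function merge_equal :: "out_neuron list \<Rightarrow> out_neuron list" where
  "merge_equal [] = []"
| "merge_equal ((v, ws) # vs) =
     (v, map (\<lambda>k. ws ! k + (\<Sum>(v', ws')\<leftarrow>filter (\<lambda>(v', _). neuron_map v' = neuron_map v) vs. ws' ! k))
           [0..<length ws])
     # merge_equal (filter (\<lambda>(v', _). neuron_map v' \<noteq> neuron_map v) vs)"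
  by pat_completeness auto
termination
  by (relation "measure length") (auto simp: less_Suc_eq_le)

definition aggregate :: "out_neuron list \<Rightarrow> out_neuron list" where
  "aggregate vs = filter (\<lambda>(v, ws). \<exists>w\<in>set ws. w \<noteq> 0) (merge_equal vs)"

definition set_incoming :: "out_neuron list \<Rightarrow> neuron list \<Rightarrow> neuron list" where
  "set_incoming vs next_level =
     map (\<lambda>k. (next_level ! k)\<lparr>weights := map (\<lambda>(v, ws). ws ! k) vs\<rparr>) [0..<length next_level]"

text \<open>The recursive call comes first: the levels are processed from the last hidden one down.\<close>

fun relu_layers :: "neuron list list \<Rightarrow> neuron list list" where
  "relu_layers [] = []"
| "relu_layers [l] = [l]"
| "relu_layers (l # l' # ls) =
     (let above = relu_layers (l' # ls);
          vs = aggregate (concat (map relu_split (with_outgoing l (hd above))))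
      in map fst vs # set_incoming vs (hd above) # tl above)"

definition finish_output :: "network \<Rightarrow> network" where
  "finish_output N =
     (let v = hd (last (layers N));
          N' = N\<lparr>layers := butlast (layers N) @ [[v\<lparr>act := Ident\<rparr>]]\<rparr>
      in if \<forall>x\<in>unit_cube (inputs N). 0 \<le> realization N' x \<and> realization N' x \<le> 1 then N'
         else N\<lparr>layers := butlast (layers N) @
                [[v\<lparr>act := Relu\<rparr>, v\<lparr>bias := bias v - 1, act := Relu\<rparr>],
                 [\<lparr>weights = [1, -1], bias = 0, act = Ident\<rparr>]]\<rparr>)"

definition constr :: "subst_graph \<Rightarrow> network" where
  "constr G = finish_output \<lparr>inputs = variables G,
     layers = relu_layers (read_layers (variables G) (formulae G))\<rparr>"

end

theory Submission
  imports Defs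
begin

text \<open>
  A hidden node \<open>v\<close> has an integer upper bound \<open>c\<close>, and \<open>\<rho>(t) = \<sigma>(t) + \<sigma>(t - 1) + \<dots> + \<sigma>(t - c + 1)\<close> for
  \<open>t \<le> c\<close>. Non-degeneracy makes each of these copies non-constant on the unit cube, where a
  non-constant \<open>\<sigma>(f)\<close> with \<open>f\<close> affine determines \<open>f\<close>; so the construction reads back exactly the
  \<open>\<sigma>\<close>-network of the extraction. It then writes the \<open>k\<close>-th copy as \<open>\<rho>(t - k) - \<rho>(t - k - 1)\<close>, where the
  second term is absent for the last copy. The outgoing weights of all shifted nodes cancel in this
  telescoping sum, so that merging leaves precisely the original nodes, in some order.
\<close>

section \<open>Minterms\<close>

text \<open>Three obstacles shape the proof. The upper bound of a node is taken over the unit cube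
  of the converted parents, whereas non-degeneracy speaks only of values reached from the network
  input. The two are joined by spreading a value x_i in [0, c_i] of the i-th parent as x_i / c_i
  over its c_i copies: every reached value vector becomes a point of that cube with the same
  pre-activation, so a reached zero and a reached positive value persist there.

  Nodes of one level may be integer shifts of each other, so copies of different nodes can share a
  local map and merge. Cancellation is therefore counted per local map, by an additive total of
  outgoing weights, and never per original node.

  The output node is not assumed to be non-constant. If its clipped map is constant on the cube,
  integrality of the weights and the range [0, 1] force zero weights and bias 0 or 1, which is the
  form that the construction gives to constant nodes.\<close>

lemma clipped_relu_peel:
  assumes "0 \<le> x" "x \<le> 1"
  shows "max 0 (min 1 (clipped_relu t + x) + clipped_relu (t + 1) - 1) = clipped_relu (t + x)"
  using assms by (auto simp: clipped_relu_def max_def min_def)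

lemma clipped_relu_bounds: "0 \<le> clipped_relu t" "clipped_relu t \<le> 1"
  by (auto simp: clipped_relu_def)

lemma clipped_relu_one_minus: "clipped_relu (1 - t) = 1 - clipped_relu t"
  by (auto simp: clipped_relu_def max_def min_def)

lemma zero_in_unit_cube: "(\<lambda>_. 0) \<in> unit_cube d"
  by (simp add: unit_cube_def)

section \<open>Values and bounds of affine functions on the unit cube\<close>

lemma aff_fun_upd:
  assumes "i < length ws"
  shows "aff ws b (x(i := t)) = aff ws b x + ws ! i * (t - x i)"
proof -
  have "(\<Sum>j<length ws. ws ! j * (x(i := t)) j) =
      (\<Sum>j<length ws. ws ! j * x j + (if j = i then ws ! j * (t - x j) else 0))"
    by (intro sum.cong) (auto simp: algebra_simps)
  then show ?thesis
    using assms by (simp add: aff_def sum.distrib)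
qed

lemma aff_convex_combination:
  "aff ws b (\<lambda>i. (1 - s) * x i + s * y i) = (1 - s) * aff ws b x + s * aff ws b y"
  by (simp add: aff_def algebra_simps sum.distrib sum_subtractf sum_distrib_left)

lemma int_aff_list_update:
  assumes "k < length m"
  shows "int_aff (m[k := c]) b x = int_aff m b x + of_int (c - m ! k) * x k"
proof -
  have "(\<Sum>i<length m. of_int (m[k := c] ! i) * x i) =
      (\<Sum>i<length m. of_int (m ! i) * x i + (if i = k then of_int (c - m ! i) * x i else 0))"
    by (intro sum.cong) (auto simp: algebra_simps nth_list_update)
  then show ?thesis
    using assms by (simp add: int_aff_eq sum.distrib)
qed

lemma int_aff_uminus: "int_aff (map uminus m) (1 - b) x = 1 - int_aff m b x"
  by (simp add: int_aff_eq sum_negf)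

lemma aff_le:
  assumes "x \<in> unit_cube (length ws)"
  shows "aff ws b x \<le> b + (\<Sum>i<length ws. max (ws ! i) 0)"
proof -
  have "ws ! i * x i \<le> max (ws ! i) 0" if "i < length ws" for i
    using assms that
    by (cases "ws ! i > 0") (auto simp: unit_cube_def intro!: mult_left_le mult_nonpos_nonneg)
  then show ?thesis
    by (auto simp: aff_def intro!: sum_mono)
qed

lemma le_aff:
  assumes "x \<in> unit_cube (length ws)"
  shows "b + (\<Sum>i<length ws. min (ws ! i) 0) \<le> aff ws b x"
proof -
  have "aff (map uminus ws) (- b) x \<le> - b + (\<Sum>i<length ws. max (- (ws ! i)) 0)"
    using aff_le[of x "map uminus ws" "- b"] assms by simp
  moreover have "aff (map uminus ws) (- b) x = - aff ws b x"
    by (simp add: aff_def sum_negf)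
  moreover have "(\<Sum>i<length ws. max (- (ws ! i)) 0) = - (\<Sum>i<length ws. min (ws ! i) 0)"
    unfolding sum_negf[symmetric] by (intro sum.cong) auto
  ultimately show ?thesis
    by linarith
qed

lemma int_aff_bounds:
  assumes "x \<in> unit_cube (length m)"
  shows "cube_min m b \<le> int_aff m b x" "int_aff m b x \<le> cube_max m b"
proof -
  have "(\<Sum>i<length m. min (map real_of_int m ! i) 0) = (\<Sum>i<length m. of_int (min (m ! i) 0))"
    "(\<Sum>i<length m. max (map real_of_int m ! i) 0) = (\<Sum>i<length m. of_int (max (m ! i) 0))"
    by (auto intro!: sum.cong)
  then show "cube_min m b \<le> int_aff m b x" "int_aff m b x \<le> cube_max m b"
    using le_aff[of x "map real_of_int m" "of_int b"] aff_le[of x "map real_of_int m" "of_int b"] assms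
    by (simp_all add: cube_min_eq cube_max_eq int_aff_def)
qed

text \<open>Removing a summand \<open>FZero\<close> also removes the truncation at 1, so the
  remaining value must already be at most 1; dually for \<open>FOne\<close> and the truncation at
  0.\<close>

lemma truth_oplus_simp:
  assumes "truth \<psi> x \<le> 1"
  shows "truth (oplus_simp \<phi> \<psi>) x = truth (Oplus \<phi> \<psi>) x"
  using assms by auto

lemma truth_odot_simp:
  assumes "0 \<le> truth \<phi> x"
  shows "truth (odot_simp \<phi> \<psi>) x = truth (Odot \<phi> \<psi>) x"
  using assms by auto

lemma truth_EXTR:
  assumes "x \<in> unit_cube (length m)"
  shows "truth (EXTR m b) x = clipped_relu (int_aff m b x)"
  using assms
proof (induction m b rule: EXTR.induct)
  case (1 m b)
  note bounds = int_aff_bounds[OF 1(4), of b]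
  consider "cube_min m b \<ge> 1" | "\<not> cube_min m b \<ge> 1" "cube_max m b \<le> 0"
    | "\<not> cube_min m b \<ge> 1" "\<not> cube_max m b \<le> 0" by blast
  then show ?case
  proof cases
    case 1
    then have "EXTR m b = FOne"
      by (subst EXTR.simps) simp
    then show ?thesis
      using 1 bounds by (simp add: clipped_relu_def)
  next
    case 2
    then have "EXTR m b = FZero"
      by (subst EXTR.simps) simp
    then show ?thesis
      using 2 bounds by (simp add: clipped_relu_def)
  next
    case 3
    define k where "k = lead_index m"
    have k: "k < length m" "m ! k \<noteq> 0"
      using lead_index[OF 3] by (simp_all add: k_def)
    have x: "0 \<le> x k" "x k \<le> 1"
      using 1(4) k by (simp_all add: unit_cube_def)
    show ?thesis
    proof (cases "m ! k \<ge> 1")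
      case True
      define m' where "m' = m[k := m ! k - 1]"
      have "EXTR m b = odot_simp (oplus_simp (EXTR m' b) (Var k)) (EXTR m' (b + 1))"
        using 3 True by (subst EXTR.simps) (simp add: k_def[symmetric] m'_def Let_def)
      moreover have "truth (EXTR m' b) x = clipped_relu (int_aff m' b x)"
        "truth (EXTR m' (b + 1)) x = clipped_relu (int_aff m' (b + 1) x)"
        using 1(1)[OF 3 k_def True] 1(2)[OF 3 k_def True] 1(4) by (simp_all add: m'_def)
      moreover have "int_aff m' b x = int_aff m b x - x k"
        "int_aff m' (b + 1) x = int_aff m b x - x k + 1"
        using int_aff_list_update[OF k(1), of "m ! k - 1" _ x]
        by (simp_all add: m'_def) (simp add: int_aff_eq)
      \<comment> \<open>The identity \<sigma>(t + x) = (\<sigma>(t) \<oplus> x) \<odot> \<sigma>(t +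
        1) for x in [0, 1], at t = f - x_k, is what the positive branch of \<open>EXTR\<close>
        encodes.\<close>
      ultimately show ?thesis
        using x clipped_relu_peel[OF x, of "int_aff m b x - x k"]
          clipped_relu_bounds[of "int_aff m b x - x k"]
        by (simp add: truth_oplus_simp truth_odot_simp del: oplus_simp.simps odot_simp.simps)
    next
      case False
      have "EXTR m b = Neg (EXTR (map uminus m) (1 - b))"
        using 3 False by (subst EXTR.simps) (simp add: k_def[symmetric] Let_def)
      moreover have "truth (EXTR (map uminus m) (1 - b)) x = 1 - clipped_relu (int_aff m b x)"
        using 1(3)[OF 3 k_def False] 1(4) by (simp add: int_aff_uminus clipped_relu_one_minus)
      ultimately show ?thesis
        by simp
    qed
  qed
qed

text \<open>Each weight is a difference quotient along one axis through \<open>z\<close>, so one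
  further point of agreement per axis suffices. Only finitely many points near \<open>z\<close> thus
  have to be kept inside the region where an activation is injective.\<close>

lemma aff_eqI:
  assumes "length ws = length ws'" "aff ws b z = aff ws' b' z"
    and "\<And>i. i < length ws \<Longrightarrow> \<exists>t. t \<noteq> z i \<and> aff ws b (z(i := t)) = aff ws' b' (z(i := t))"
  shows "ws = ws' \<and> b = b'"
proof -
  have "ws ! i = ws' ! i" if "i < length ws" for i
    using assms(3)[OF that] assms(1,2) that by (auto simp: aff_fun_upd)
  then have "ws = ws'"
    using assms(1) by (auto intro: nth_equalityI)
  with assms(2) show ?thesis
    by (simp add: aff_def)
qed

text \<open>The ReLU is the identity where the affine function is positive. A nonzero weight
  provides a point \<open>z\<close> with value 1, and a unit step along any axis, in the direction
  given by the sign of the weight, does not decrease the value and so stays in the positive half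
  space.\<close>

lemma relu_aff_inject:
  assumes "length ws = length ws'" "i < length ws" "ws ! i \<noteq> 0"
    and eq: "\<And>x. relu (aff ws b x) = relu (aff ws' b' x)"
  shows "ws = ws' \<and> b = b'"
proof -
  have pos: "aff ws' b' x = aff ws b x" if "aff ws b x > 0" for x
    using eq[of x] that by (auto simp: relu_def max_def split: if_splits)
  define z where "z = (\<lambda>_. 0 :: real)(i := (1 - b) / ws ! i)"
  have z: "aff ws b z = 1"
    using assms(2,3) by (simp add: z_def aff_fun_upd) (simp add: aff_def)
  show ?thesis
  proof (rule aff_eqI[where z = z])
    fix j assume j: "j < length ws"
    let ?t = "z j + (if ws ! j \<ge> 0 then 1 else - 1)"
    have "aff ws b (z(j := ?t)) > 0"
      using j z by (simp add: aff_fun_upd)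
    then show "\<exists>t. t \<noteq> z j \<and> aff ws b (z(j := t)) = aff ws' b' (z(j := t))"
      using pos by (intro exI[of _ ?t]) auto
  qed (use assms z pos in auto)
qed

text \<open>Either an endpoint already has its value strictly between 0 and 1, or the two values
  straddle this interval and the segment, which stays in the convex cube, crosses it.\<close>

lemma ex_aff_in_unit_interval:
  assumes x: "x \<in> unit_cube d" and y: "y \<in> unit_cube d"
    and lt: "clipped_relu (aff ws b x) < clipped_relu (aff ws b y)"
  shows "\<exists>z\<in>unit_cube d. 0 < aff ws b z \<and> aff ws b z < 1"
proof -
  have *: "aff ws b x < 1" "0 < aff ws b y"
    using lt by (auto simp: clipped_relu_def max_def min_def split: if_splits)
  consider "0 < aff ws b x" | "aff ws b y < 1" | "aff ws b x \<le> 0" "1 \<le> aff ws b y"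
    by linarith
  then show ?thesis
  proof cases
    case 3
    \<comment> \<open>Solved from the requirement that the affine value at parameter
      \<open>s\<close> on the segment from \<open>x\<close> to \<open>y\<close> be 1 / 2.\<close>
    define s where "s = (1 / 2 - aff ws b x) / (aff ws b y - aff ws b x)"
    have s: "0 \<le> s" "s \<le> 1" and eq: "s * (aff ws b y - aff ws b x) = 1 / 2 - aff ws b x"
      using 3 by (auto simp: s_def field_simps)
    let ?z = "\<lambda>i. (1 - s) * x i + s * y i"
    have "aff ws b ?z = 1 / 2"
      unfolding aff_convex_combination using eq by (simp add: algebra_simps)
    moreover have "?z \<in> unit_cube d"
      using x y s convex_bound_le[of _ 1 _ "1 - s" s] by (auto simp: unit_cube_def)
    ultimately show ?thesis
      by (intro bexI[of _ ?z]) auto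
  qed (use * x y in auto)
qed

text \<open>Clipping loses nothing strictly between 0 and 1, and non-constancy gives a point of the
  cube with such a value. This point may lie on the boundary of the cube, so along each axis it can
  only be moved towards the interior.\<close>

lemma clipped_relu_aff_inject:
  assumes len: "length ws = d" "length ws' = d"
    and x: "x \<in> unit_cube d" and y: "y \<in> unit_cube d"
    and ne: "clipped_relu (aff ws b x) \<noteq> clipped_relu (aff ws b y)"
    and eq: "\<And>x. x \<in> unit_cube d \<Longrightarrow> clipped_relu (aff ws b x) = clipped_relu (aff ws' b' x)"
  shows "ws = ws' \<and> b = b'"
proof -
  obtain z where z: "z \<in> unit_cube d" "0 < aff ws b z" "aff ws b z < 1"
    using ex_aff_in_unit_interval[OF x y, of ws b] ex_aff_in_unit_interval[OF y x, of ws b] ne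
    by (meson linorder_neqE_linordered_idom)
  have inside: "aff ws b u = aff ws' b' u" if "u \<in> unit_cube d" "0 < aff ws b u" "aff ws b u < 1" for u
    using eq[OF that(1)] that(2,3) by (auto simp: clipped_relu_def max_def min_def split: if_splits)
  show ?thesis
  proof (rule aff_eqI[where z = z])
    fix i assume i: "i < length ws"
    \<comment> \<open>Here \<open>r\<close> is the distance of the value at \<open>z\<close> to the
      ends of (0, 1). The step \<open>e\<close> changes the value by less than \<open>r\<close>,
      where the summand 1 covers a zero weight. The cap 1 / 2 keeps the point in the cube, since
      \<open>t\<close> moves towards the centre.\<close>
    define r where "r = min (aff ws b z) (1 - aff ws b z)"
    define e where "e = min (1 / 2) (r / (\<bar>ws ! i\<bar> + 1))"
    define t where "t = (if z i \<le> 1 / 2 then z i + e else z i - e)"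
    have r: "r > 0"
      using z by (simp add: r_def)
    then have "0 < e"
      by (auto simp: e_def)
    moreover have "e \<le> 1 / 2"
      unfolding e_def by (rule min.cobounded1)
    ultimately have e: "0 < e" "e \<le> 1 / 2" by simp_all
    have "e * \<bar>ws ! i\<bar> \<le> r / (\<bar>ws ! i\<bar> + 1) * \<bar>ws ! i\<bar>"
      by (intro mult_right_mono) (auto simp: e_def)
    also have "\<dots> < r"
      using r by (simp add: field_simps)
    finally have "\<bar>ws ! i * (t - z i)\<bar> < r"
      using e by (simp add: t_def abs_mult mult.commute)
    then have "0 < aff ws b (z(i := t))" "aff ws b (z(i := t)) < 1"
      using i by (auto simp: aff_fun_upd r_def)
    moreover have "z(i := t) \<in> unit_cube d"
      using z(1) e i len by (auto simp: unit_cube_def t_def)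
    ultimately show "\<exists>t. t \<noteq> z i \<and> aff ws b (z(i := t)) = aff ws' b' (z(i := t))"
      using inside e by (intro exI[of _ t]) (auto simp: t_def)
  qed (use inside z len in auto)
qed

lemma map_of_int_floor: "set ws \<subseteq> \<int> \<Longrightarrow> map real_of_int (map floor ws) = ws"
  by (induction ws) auto

lemma truth_node_formula:
  assumes "set (weights u) \<subseteq> \<int>" "bias u \<in> \<int>" "act u = Sigma" "x \<in> unit_cube (length (weights u))"
  shows "truth (node_formula u) x = neuron_map u x"
proof -
  have "int_aff (map floor (weights u)) \<lfloor>bias u\<rfloor> x = aff (weights u) (bias u) x"
    using assms(1,2) unfolding int_aff_def map_of_int_floor[OF assms(1)] by simp
  then show ?thesis
    using assms by (simp add: node_formula_def truth_EXTR neuron_map_def)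
qed

text \<open>A formula with non-constant truth function determines weights and bias by injectivity of
  the clipped affine map. For a constant one \<open>sigma_neuron\<close> returns zero weights with
  the constant as bias, so a constant node is recovered only if it already has this shape; hence the
  second alternative of the hypothesis.\<close>

lemma sigma_neuron_node_formula:
  fixes u :: neuron
  assumes len: "length (weights u) = d" and int: "set (weights u) \<subseteq> \<int>" "bias u \<in> \<int>"
    and act: "act u = Sigma"
    and "(\<exists>x\<in>unit_cube d. \<exists>y\<in>unit_cube d. neuron_map u x \<noteq> neuron_map u y) \<or>
      weights u = replicate d 0 \<and> (bias u = 0 \<or> bias u = 1)"
  shows "sigma_neuron d (node_formula u) = u"
proof -
  have truth: "truth (node_formula u) x = neuron_map u x" if "x \<in> unit_cube d" for x
    using truth_node_formula[OF int act] that len by simp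
  from assms(5) show ?thesis
  proof
    assume "\<exists>x\<in>unit_cube d. \<exists>y\<in>unit_cube d. neuron_map u x \<noteq> neuron_map u y"
    then obtain x y where xy: "x \<in> unit_cube d" "y \<in> unit_cube d" "neuron_map u x \<noteq> neuron_map u y"
      by blast
    then have nc: "\<not> (\<exists>c. \<forall>x\<in>unit_cube d. truth (node_formula u) x = c)"
      using truth by metis
    let ?m = "map floor (weights u)" and ?b = "\<lfloor>bias u\<rfloor>"
    have map: "map real_of_int ?m = weights u" and b: "real_of_int ?b = bias u"
      using map_of_int_floor[OF int(1)] int(2) by simp_all
    have aff_eq: "int_aff ?m ?b = aff (weights u) (bias u)"
      unfolding int_aff_def map b by (rule refl)
    have the: "(THE (m, b). length m = d \<and>
        (\<forall>x\<in>unit_cube d. truth (node_formula u) x = clipped_relu (int_aff m b x))) = (?m, ?b)"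
    proof (rule the_equality)
      show "case (?m, ?b) of (m, b) \<Rightarrow> length m = d \<and>
          (\<forall>x\<in>unit_cube d. truth (node_formula u) x = clipped_relu (int_aff m b x))"
        using truth len aff_eq by (simp add: neuron_map_def act)
    next
      fix p :: "int list \<times> int"
      assume "case p of (m, b) \<Rightarrow> length m = d \<and>
          (\<forall>x\<in>unit_cube d. truth (node_formula u) x = clipped_relu (int_aff m b x))"
      then obtain m b where p: "p = (m, b)" "length m = d"
        and eq: "\<And>x. x \<in> unit_cube d \<Longrightarrow> truth (node_formula u) x = clipped_relu (int_aff m b x)"
        by (cases p) auto
      have "weights u = map real_of_int m \<and> bias u = real_of_int b"
      proof (rule clipped_relu_aff_inject[OF len _ xy(1,2)])
        show "clipped_relu (aff (weights u) (bias u) x) \<noteq> clipped_relu (aff (weights u) (bias u) y)"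
          using xy(3) by (simp add: neuron_map_def act)
        show "clipped_relu (aff (weights u) (bias u) x) =
            clipped_relu (aff (map real_of_int m) (real_of_int b) x)" if "x \<in> unit_cube d" for x
          using eq[OF that] truth[OF that] by (simp add: neuron_map_def act int_aff_def)
      qed (use p in simp)
      then show "p = (?m, ?b)"
        by (simp add: p comp_def)
    qed
    show ?thesis
      unfolding sigma_neuron_def if_not_P[OF nc] the by (simp add: map b act del: map_map)
  next
    assume u: "weights u = replicate d 0 \<and> (bias u = 0 \<or> bias u = 1)"
    then have "truth (node_formula u) x = bias u" if "x \<in> unit_cube d" for x
      using truth[OF that] by (auto simp: neuron_map_def act aff_def clipped_relu_def)
    moreover from this have "(THE c. \<forall>x\<in>unit_cube d. truth (node_formula u) x = c) = bias u"
      using zero_in_unit_cube by (intro the_equality) auto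
    ultimately have "sigma_neuron d (node_formula u) =
        \<lparr>weights = replicate d 0, bias = bias u, act = Sigma\<rparr>"
      unfolding sigma_neuron_def by auto
    then show ?thesis
      using u act by simp
  qed
qed


section \<open>Copies of nodes\<close>

text \<open>
  \<open>select_inputs p v\<close> lets the \<open>t\<close>-th input of the new node play the role of the \<open>(p ! t)\<close>-th
  input of \<open>v\<close>; this covers both duplicating and permuting the nodes of the level below.
\<close>

definition select_inputs :: "nat list \<Rightarrow> neuron \<Rightarrow> neuron" where
  "select_inputs p v = v\<lparr>weights := map (\<lambda>i. weights v ! i) p\<rparr>"

lemma select_inputs_sel [simp]:
  "weights (select_inputs p v) = map (\<lambda>i. weights v ! i) p"
  "bias (select_inputs p v) = bias v"
  "act (select_inputs p v) = act v"
  by (simp_all add: select_inputs_def)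

text \<open>Entry \<open>t\<close> is the original node of which the \<open>t\<close>-th node of the
  converted level is a copy: for \<open>cs = [2, 1]\<close> the list is
  \<open>[0, 0, 1]\<close>.\<close>

definition owner :: "nat list \<Rightarrow> nat list" where
  "owner cs = concat (map2 replicate cs [0..<length cs])"

lemma map_concat_replicate:
  "concat (map2 replicate cs (map f xs)) = map f (concat (map2 replicate cs xs))"
  by (simp add: map_concat zip_map2 case_prod_beta' comp_def)

lemma concat_replicate_owner:
  assumes "length ws = length cs"
  shows "concat (map2 replicate cs ws) = map (\<lambda>i. ws ! i) (owner cs)"
  using map_concat_replicate[of cs "\<lambda>i. ws ! i" "[0..<length ws]", unfolded map_nth]
  unfolding owner_def assms .

lemma expand_weights_owner:
  assumes "length (weights v) = length cs"
  shows "expand_weights cs v = select_inputs (owner cs) v"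
  by (simp add: expand_weights_def select_inputs_def concat_replicate_owner[OF assms])

lemma length_concat_replicate:
  "length cs = length xs \<Longrightarrow> length (concat (map2 replicate cs xs)) = sum_list cs"
  by (induction cs xs rule: list_induct2) auto

lemma length_owner: "length (owner cs) = sum_list cs"
  by (simp add: owner_def length_concat_replicate)

lemma set_concat_replicate:
  "length cs = length xs \<Longrightarrow> \<forall>c\<in>set cs. 1 \<le> c \<Longrightarrow> set (concat (map2 replicate cs xs)) = set xs"
  by (induction cs xs rule: list_induct2) auto

lemma set_owner: "\<forall>c\<in>set cs. 1 \<le> c \<Longrightarrow> set (owner cs) = {..<length cs}"
  by (simp add: owner_def set_concat_replicate atLeast0LessThan del: set_concat)

lemma sum_list_concat_replicate:
  fixes g :: "'a \<Rightarrow> real"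
  shows "length cs = length xs \<Longrightarrow>
    sum_list (map g (concat (map2 replicate cs xs))) = (\<Sum>(c, x)\<leftarrow>zip cs xs. real c * g x)"
  by (induction cs xs rule: list_induct2) (auto simp: sum_list_replicate)

lemma sum_list_owner:
  fixes g :: "nat \<Rightarrow> real"
  shows "sum_list (map g (owner cs)) = (\<Sum>i<length cs. real (cs ! i) * g i)"
  unfolding owner_def
  by (subst sum_list_concat_replicate) (simp_all add: sum_list_sum_nth atLeast0LessThan)

lemma owner_replicate_1: "owner (replicate n 1) = [0..<n]"
proof -
  have "concat (map2 replicate (replicate (length xs) 1) xs) = xs" for xs :: "nat list"
    by (induction xs) auto
  from this[of "[0..<n]"] show ?thesis
    by (simp add: owner_def)
qed

text \<open>Since \<open>p\<close> meets every input, each weight of \<open>v\<close> reappears in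
  the new node. Distinct nodes of a level thus remain distinct after their parents are
  copied.\<close>

lemma select_inputs_inject:
  fixes v v' :: neuron
  assumes "select_inputs p v = select_inputs p v'" "set p = {..<d}"
    and "length (weights v) = d" "length (weights v') = d"
  shows "v = v'"
proof -
  have "weights v ! i = weights v' ! i" if "i < d" for i
    using arg_cong[OF assms(1), of weights] that assms(2) by auto
  then have "weights v = weights v'"
    using assms(3,4) by (auto intro: nth_equalityI)
  moreover have "bias v = bias v'" "act v = act v'"
    using arg_cong[OF assms(1), of bias] arg_cong[OF assms(1), of act] by simp_all
  ultimately show ?thesis
    by simp
qed

text \<open>
  \<open>X\<close> is meant to be the set of value vectors that a level of a network takes on the unit cube,
  and \<open>cs\<close> counts the copies by which the nodes of this level are replaced.
\<close>

definition spans :: "nat list \<Rightarrow> (nat \<Rightarrow> real) set \<Rightarrow> bool" where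
  "spans cs X \<longleftrightarrow> X \<noteq> {} \<and> (\<forall>c\<in>set cs. 1 \<le> c) \<and>
     (\<forall>x\<in>X. \<forall>i<length cs. 0 \<le> x i \<and> x i \<le> real (cs ! i)) \<and>
     (\<forall>i<length cs. (\<exists>x\<in>X. x i = 0) \<and> (\<exists>x\<in>X. x i > 0))"

text \<open>Each value is spread evenly over the copies of its node.\<close>

lemma ex_unit_cube_select_inputs:
  assumes cs: "\<forall>c\<in>set cs. 1 \<le> c"
    and x: "\<forall>i<length cs. 0 \<le> x i \<and> x i \<le> real (cs ! i)"
  shows "\<exists>y\<in>unit_cube (sum_list cs). \<forall>v. length (weights v) = length cs \<longrightarrow>
    aff (weights (select_inputs (owner cs) v)) b y = aff (weights v) b x"
proof (intro bexI allI impI)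
  let ?y = "\<lambda>t. x (owner cs ! t) / real (cs ! (owner cs ! t))"
  have pos: "1 \<le> cs ! i" if "i < length cs" for i
    using cs that by simp
  have "owner cs ! t < length cs" if "t < sum_list cs" for t
  proof -
    have "owner cs ! t \<in> set (owner cs)"
      using that by (simp add: length_owner)
    then show ?thesis
      by (simp add: set_owner[OF cs])
  qed
  moreover have "0 \<le> x i / real (cs ! i) \<and> x i / real (cs ! i) \<le> 1" if "i < length cs" for i
    using x pos[OF that] that by (simp add: divide_le_eq_1)
  ultimately show "?y \<in> unit_cube (sum_list cs)"
    by (simp add: unit_cube_def)
  fix v :: neuron assume v: "length (weights v) = length cs"
  have "(\<Sum>t<sum_list cs. weights v ! (owner cs ! t) * ?y t) =
      sum_list (map (\<lambda>i. weights v ! i * (x i / real (cs ! i))) (owner cs))"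
    by (simp add: sum_list_sum_nth length_owner atLeast0LessThan)
  also have "\<dots> = (\<Sum>i<length cs. weights v ! i * x i)"
    unfolding sum_list_owner
  proof (rule sum.cong)
    fix i assume "i \<in> {..<length cs}"
    then have "real (cs ! i) \<noteq> 0"
      using pos[of i] by simp
    then show "real (cs ! i) * (weights v ! i * (x i / real (cs ! i))) = weights v ! i * x i"
      by simp
  qed simp
  finally show "aff (weights (select_inputs (owner cs) v)) b ?y = aff (weights v) b x"
    by (simp add: aff_def length_owner v)
qed

section \<open>Upper bounds and the number of copies\<close>

lemma upper_eq: "upper v = bias v + (\<Sum>i<length (weights v). max (weights v ! i) 0)"
  by (simp add: upper_def sum_list_sum_nth atLeast0LessThan)

lemma aff_le_upper:
  "x \<in> unit_cube (length (weights v)) \<Longrightarrow> aff (weights v) (bias v) x \<le> upper v"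
  unfolding upper_eq by (rule aff_le)

lemma ex_aff_eq_upper:
  "\<exists>x\<in>unit_cube (length (weights v)). aff (weights v) (bias v) x = upper v"
  by (rule bexI[of _ "\<lambda>i. if weights v ! i > 0 then 1 else 0"])
    (auto simp: upper_eq aff_def unit_cube_def intro!: sum.cong)

lemma upper_Ints: "set (weights v) \<subseteq> \<int> \<Longrightarrow> bias v \<in> \<int> \<Longrightarrow> upper v \<in> \<int>"
  unfolding upper_eq by (intro Ints_add Ints_sum) (auto simp: max_def)

text \<open>Non-degeneracy of one hidden node, put on the pre-activation and restricted to the
  values \<open>X\<close> that the level below actually takes. A zero of the ReLU is a
  pre-activation that is at most 0.\<close>

definition hidden_neuron :: "nat \<Rightarrow> (nat \<Rightarrow> real) set \<Rightarrow> neuron \<Rightarrow> bool" where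
  "hidden_neuron d X v \<longleftrightarrow> length (weights v) = d \<and> set (weights v) \<subseteq> \<int> \<and> bias v \<in> \<int> \<and>
     act v = Relu \<and> (\<exists>x\<in>X. aff (weights v) (bias v) x > 0) \<and>
     (\<exists>x\<in>X. aff (weights v) (bias v) x \<le> 0)"

lemma Ints_select_inputs:
  assumes "set (weights v) \<subseteq> \<int>" "set p \<subseteq> {..<length (weights v)}"
  shows "set (weights (select_inputs p v)) \<subseteq> \<int>"
  using assms by (auto simp: subset_iff)

lemma spans_select_inputs:
  assumes "spans cs X" "x \<in> X" "length (weights v) = length cs"
  shows "\<exists>y\<in>unit_cube (sum_list cs).
    aff (weights (select_inputs (owner cs) v)) (bias v) y = aff (weights v) (bias v) x"
  using ex_unit_cube_select_inputs[of cs x "bias v"] assms unfolding spans_def by blast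

lemma aff_le_upper_select_inputs:
  assumes "spans cs X" "x \<in> X" "length (weights v) = length cs"
  shows "aff (weights v) (bias v) x \<le> upper (select_inputs (owner cs) v)"
proof -
  obtain y where "y \<in> unit_cube (sum_list cs)"
    "aff (weights (select_inputs (owner cs) v)) (bias v) y = aff (weights v) (bias v) x"
    using spans_select_inputs[OF assms] by blast
  then show ?thesis
    using aff_le_upper[of y "select_inputs (owner cs) v"] by (simp add: length_owner)
qed

lemma set_owner_spans: "spans cs X \<Longrightarrow> set (owner cs) = {..<length cs}"
  by (simp add: spans_def set_owner)

text \<open>Integer weights make the bound an integer. It is positive because some vector of
  \<open>X\<close> gives a positive pre-activation, and this value is also attained on the cube of
  the copies. So the bound counts the copies exactly.\<close>

lemma upper_hidden:
  assumes "spans cs X" "hidden_neuron (length cs) X v"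
  shows "\<exists>c\<ge>1. upper (select_inputs (owner cs) v) = real c"
proof -
  let ?v = "select_inputs (owner cs) v"
  obtain x where "x \<in> X" "aff (weights v) (bias v) x > 0"
    using assms(2) by (auto simp: hidden_neuron_def)
  then have "upper ?v > 0"
    using aff_le_upper_select_inputs[OF assms(1), of x v] assms(2) by (auto simp: hidden_neuron_def)
  moreover have "upper ?v \<in> \<int>"
    using assms set_owner_spans[OF assms(1)]
    by (intro upper_Ints Ints_select_inputs) (auto simp: hidden_neuron_def)
  then obtain k where "upper ?v = of_int k"
    by (auto elim: Ints_cases)
  ultimately show ?thesis
    by (intro exI[of _ "nat k"]) auto
qed

definition num_copies :: "neuron \<Rightarrow> nat" where
  "num_copies v = nat \<lceil>upper v\<rceil>"

lemma num_copies_hidden: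
  assumes "spans cs X" "hidden_neuron (length cs) X v"
  shows "1 \<le> num_copies (select_inputs (owner cs) v)"
    "upper (select_inputs (owner cs) v) = real (num_copies (select_inputs (owner cs) v))"
  using upper_hidden[OF assms] by (auto simp: num_copies_def)

definition lowered :: "neuron \<Rightarrow> nat \<Rightarrow> neuron" where
  "lowered v k = v\<lparr>bias := bias v - real k\<rparr>"

lemma lowered_sel [simp]:
  "weights (lowered v k) = weights v" "bias (lowered v k) = bias v - real k"
  "act (lowered v k) = act v" "upper (lowered v k) = upper v - real k" "lowered v 0 = v"
  by (simp_all add: lowered_def upper_def)

text \<open>For the bound 1 the unshifted node is the list of shifts with the single entry 0, so one
  formula describes both branches of \<open>sigma_copies\<close>.\<close>

lemma sigma_copies_eq:
  assumes "1 \<le> num_copies v" "upper v = real (num_copies v)"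
  shows "sigma_copies v = map (\<lambda>k. (lowered v k)\<lparr>act := Sigma\<rparr>) [0..<num_copies v]"
proof (cases "num_copies v = 1")
  case True
  with assms show ?thesis
    by (simp add: sigma_copies_def)
next
  case False
  with assms show ?thesis
    by (simp add: sigma_copies_def lowered_def)
qed

text \<open>Every copy takes both values 0 and 1 on the cube of its inputs. The value 0 comes from a
  vector of \<open>X\<close>, spread over the copies, whose pre-activation is at most 0. The value 1
  comes from a vertex that attains the bound, since the shift \<open>k\<close> is at least 1 below
  it; this vertex need not come from a vector of \<open>X\<close>.\<close>

lemma sigma_neuron_copy:
  assumes "spans cs X" "hidden_neuron (length cs) X v"
    and u: "u \<in> set (sigma_copies (select_inputs (owner cs) v))"
  shows "sigma_neuron (sum_list cs) (node_formula u) = u"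
proof -
  let ?v = "select_inputs (owner cs) v"
  note c = num_copies_hidden[OF assms(1,2)]
  obtain k where k: "k < num_copies ?v" "u = (lowered ?v k)\<lparr>act := Sigma\<rparr>"
    using u unfolding sigma_copies_eq[OF c] by auto
  have map: "neuron_map u x = clipped_relu (aff (weights ?v) (bias ?v) x - real k)" for x
    by (simp add: k neuron_map_def aff_def algebra_simps)
  obtain x where "x \<in> X" "aff (weights v) (bias v) x \<le> 0"
    using assms(2) by (auto simp: hidden_neuron_def)
  then obtain y where y: "y \<in> unit_cube (sum_list cs)" "aff (weights ?v) (bias ?v) y \<le> 0"
    using spans_select_inputs[OF assms(1), of x v] assms(2) by (auto simp: hidden_neuron_def)
  obtain z where z: "z \<in> unit_cube (sum_list cs)" "aff (weights ?v) (bias ?v) z = upper ?v"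
    using ex_aff_eq_upper[of ?v] by (auto simp: length_owner)
  have "neuron_map u y = 0"
    unfolding map using y by (simp add: clipped_relu_def)
  moreover have "neuron_map u z = 1"
    unfolding map using z c(2) k(1) by (simp add: clipped_relu_def)
  ultimately have "\<exists>x\<in>unit_cube (sum_list cs). \<exists>y\<in>unit_cube (sum_list cs).
      neuron_map u x \<noteq> neuron_map u y"
    using y z by (metis zero_neq_one)
  moreover have "set (weights u) \<subseteq> \<int>" "bias u \<in> \<int>" "length (weights u) = sum_list cs"
    using Ints_select_inputs[of v "owner cs"] set_owner_spans[OF assms(1)] assms(2)
    by (auto simp: k hidden_neuron_def length_owner)
  ultimately show ?thesis
    by (intro sigma_neuron_node_formula) (simp_all add: k)
qed

definition output_neuron :: "nat \<Rightarrow> (nat \<Rightarrow> real) set \<Rightarrow> neuron \<Rightarrow> bool" where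
  "output_neuron d X v \<longleftrightarrow> length (weights v) = d \<and> set (weights v) \<subseteq> \<int> \<and> bias v \<in> \<int> \<and>
     (\<forall>x\<in>X. 0 \<le> aff (weights v) (bias v) x \<and> aff (weights v) (bias v) x \<le> 1)"

lemma Ints_le_minus_one: "(a :: real) \<in> \<int> \<Longrightarrow> a < 0 \<Longrightarrow> a \<le> - 1"
  by (elim Ints_cases) simp

lemma Ints_ge_one: "(a :: real) \<in> \<int> \<Longrightarrow> 0 < a \<Longrightarrow> 1 \<le> a"
  by (elim Ints_cases) simp

text \<open>
  If the weight of some input were nonzero, then changing that input from \<open>0\<close> to \<open>1\<close>, or from a
  positive value to \<open>0\<close>, would move the output away from any constant value of the activation.
\<close>

lemma sigma_neuron_output:
  assumes spans: "spans cs X" and v: "output_neuron (length cs) X v"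
  defines "u \<equiv> (select_inputs (owner cs) v)\<lparr>act := Sigma\<rparr>"
  shows "sigma_neuron (sum_list cs) (node_formula u) = u"
proof (rule sigma_neuron_node_formula)
  show int: "set (weights u) \<subseteq> \<int>" "bias u \<in> \<int>" "length (weights u) = sum_list cs"
    using Ints_select_inputs[of v "owner cs"] set_owner_spans[OF spans] v
    by (auto simp: u_def output_neuron_def length_owner)
  show "act u = Sigma"
    by (simp add: u_def)
  \<comment> \<open>Constancy on the cube of the copies yields constancy on the whole box of values
    from 0 to \<open>cs ! i\<close>, not only on \<open>X\<close>. The points with one coordinate
    changed, used below, lie in this box but possibly outside \<open>X\<close>.\<close>
  have box: "\<exists>y\<in>unit_cube (sum_list cs). neuron_map u y = clipped_relu (aff (weights v) (bias v) x)"
    if "\<forall>i<length cs. 0 \<le> x i \<and> x i \<le> real (cs ! i)" for x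
    using ex_unit_cube_select_inputs[of cs x "bias v"] that v spans
    by (fastforce simp: u_def neuron_map_def spans_def output_neuron_def)
  have X: "\<forall>i<length cs. 0 \<le> x i \<and> x i \<le> real (cs ! i)" if "x \<in> X" for x
    using spans that by (simp add: spans_def)
  show "(\<exists>x\<in>unit_cube (sum_list cs). \<exists>y\<in>unit_cube (sum_list cs). neuron_map u x \<noteq> neuron_map u y) \<or>
      weights u = replicate (sum_list cs) 0 \<and> (bias u = 0 \<or> bias u = 1)"
  proof (rule disj_imp[THEN iffD2], rule impI)
    assume "\<not> (\<exists>x\<in>unit_cube (sum_list cs). \<exists>y\<in>unit_cube (sum_list cs).
        neuron_map u x \<noteq> neuron_map u y)"
    then have const: "clipped_relu (aff (weights v) (bias v) x) = clipped_relu (aff (weights v) (bias v) y)"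
      if "\<forall>i<length cs. 0 \<le> x i \<and> x i \<le> real (cs ! i)"
        "\<forall>i<length cs. 0 \<le> y i \<and> y i \<le> real (cs ! i)" for x y
      using box[OF that(1)] box[OF that(2)] by metis
    have zero: "weights v ! i = 0" if i: "i < length cs" for i
    proof (rule ccontr)
      assume ne: "weights v ! i \<noteq> 0"
      obtain x where x: "x \<in> X" "x i = 0"
        using spans i unfolding spans_def by blast
      obtain y where y: "y \<in> X" "y i > 0"
        using spans i unfolding spans_def by blast
      have len: "i < length (weights v)"
        using v i by (simp add: output_neuron_def)
      then have "weights v ! i \<in> \<int>"
        using v nth_mem[of i "weights v"] by (auto simp: output_neuron_def)
      \<comment> \<open>A jump of at least 1 moves any value in [0, 1] to the far end of this
        interval or beyond, which pins down the constant.\<close>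
      then have wi: "weights v ! i \<le> - 1 \<or> 1 \<le> weights v ! i"
        using ne Ints_le_minus_one Ints_ge_one by (meson linorder_neqE_linordered_idom)
      have ci: "1 \<le> real (cs ! i)"
        using spans i by (simp add: spans_def)
      define f where "f = aff (weights v) (bias v)"
      have f: "0 \<le> f x" "f x \<le> 1" "0 \<le> f y" "f y \<le> 1"
        using v x y by (simp_all add: output_neuron_def f_def)
      have upd: "f (x(i := 1)) = f x + weights v ! i" "f (y(i := 0)) = f y - weights v ! i * y i"
        using aff_fun_upd[OF len] x by (simp_all add: f_def)
      have "clipped_relu (f x) = clipped_relu (f (x(i := 1)))"
        "clipped_relu (f x) = clipped_relu (f y)"
        "clipped_relu (f y) = clipped_relu (f (y(i := 0)))"
        unfolding f_def using X[OF x(1)] X[OF y(1)] ci by (intro const; simp)+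
      then have *: "f x = f y" "f x = clipped_relu (f x + weights v ! i)"
        "f y = clipped_relu (f y - weights v ! i * y i)"
        using f by (simp_all add: upd clipped_relu_def)
      from wi show False
      proof
        assume w: "weights v ! i \<le> - 1"
        then have "f x = 0"
          using *(2) f by (simp add: clipped_relu_def max_def min_def split: if_splits)
        moreover have "weights v ! i * y i < 0"
          using w y by (simp add: mult_neg_pos)
        ultimately show False
          using *(1,3) by (simp add: clipped_relu_def max_def min_def split: if_splits)
      next
        assume w: "1 \<le> weights v ! i"
        then have "f x = 1"
          using *(2) f by (simp add: clipped_relu_def max_def min_def split: if_splits)
        moreover have "weights v ! i * y i > 0"
          using w y by simp
        ultimately show False
          using *(1,3) by (simp add: clipped_relu_def max_def min_def split: if_splits)
      qed
    qed
    then have "weights u = replicate (sum_list cs) 0"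
      using set_owner_spans[OF spans] by (auto simp: u_def length_owner intro!: replicate_eqI)
    moreover have "bias v = 0 \<or> bias v = 1"
    proof -
      obtain x where "x \<in> X"
        using spans by (auto simp: spans_def)
      moreover have "aff (weights v) (bias v) x = bias v"
        using zero v by (simp add: aff_def output_neuron_def)
      ultimately have "0 \<le> bias v" "bias v \<le> 1"
        using v by (auto simp: output_neuron_def)
      moreover obtain k where k: "bias v = of_int k"
        using v by (auto simp: output_neuron_def elim: Ints_cases)
      ultimately have "0 \<le> k" "k \<le> 1"
        by simp_all
      then show ?thesis
        using k by auto
    qed
    ultimately show "weights u = replicate (sum_list cs) 0 \<and> (bias u = 0 \<or> bias u = 1)"
      by (simp add: u_def)
  qed
qed


section \<open>Reading back the extracted network\<close>

definition layer_map :: "neuron list \<Rightarrow> (nat \<Rightarrow> real) \<Rightarrow> nat \<Rightarrow> real" where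
  "layer_map l x = (\<lambda>i. if i < length l then neuron_map (l ! i) x else 0)"

text \<open>Non-degeneracy in a form that recurses through the levels: \<open>X\<close> holds the
  value vectors entering the first listed level and is replaced by its image at the next. The last
  level is treated as output, which is why the empty list is excluded.\<close>

fun admissible :: "nat \<Rightarrow> (nat \<Rightarrow> real) set \<Rightarrow> neuron list list \<Rightarrow> bool" where
  "admissible d X [] = False"
| "admissible d X [l] = (\<forall>v\<in>set l. output_neuron d X v)"
| "admissible d X (l # l' # ls) =
     (distinct l \<and> (\<forall>v\<in>set l. hidden_neuron d X v) \<and>
      (\<forall>i<length l. \<exists>v\<in>set l'. weights v ! i \<noteq> 0) \<and>
      admissible (length l) (layer_map l ` X) (l' # ls))"

lemma admissible_length_weights:
  "admissible d X (l # ls) \<Longrightarrow> v \<in> set l \<Longrightarrow> length (weights v) = d"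
  by (cases ls) (auto simp: hidden_neuron_def output_neuron_def)

definition copy_counts :: "nat list \<Rightarrow> neuron list \<Rightarrow> nat list" where
  "copy_counts cs l = map (\<lambda>v. num_copies (select_inputs (owner cs) v)) l"

text \<open>The invariant passes to the next level because a ReLU value is at most the upper bound
  of its node, and this bound is the number of its copies. Zero and positive values are reached by
  non-degeneracy.\<close>

lemma spans_layer_map:
  assumes spans: "spans cs X" and hidden: "\<And>v. v \<in> set l \<Longrightarrow> hidden_neuron (length cs) X v"
  shows "spans (copy_counts cs l) (layer_map l ` X)"
  unfolding spans_def
proof (intro conjI allI impI ballI)
  show "layer_map l ` X \<noteq> {}"
    using spans by (auto simp: spans_def)
  show "1 \<le> c" if "c \<in> set (copy_counts cs l)" for c
    using that num_copies_hidden(1)[OF spans hidden] by (auto simp: copy_counts_def)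
  fix i assume "i < length (copy_counts cs l)"
  then have i: "i < length l" and v: "hidden_neuron (length cs) X (l ! i)"
    using hidden by (simp_all add: copy_counts_def)
  have map: "layer_map l x i = relu (aff (weights (l ! i)) (bias (l ! i)) x)" for x
    using i v by (simp add: layer_map_def neuron_map_def hidden_neuron_def)
  show "\<exists>y\<in>layer_map l ` X. y i = 0" "\<exists>y\<in>layer_map l ` X. y i > 0"
    using v by (force simp: map hidden_neuron_def relu_def max_def)+
  fix y assume "y \<in> layer_map l ` X"
  then obtain x where x: "x \<in> X" "y = layer_map l x"
    by blast
  show "0 \<le> y i"
    by (simp add: x map relu_def)
  have "aff (weights (l ! i)) (bias (l ! i)) x \<le> upper (select_inputs (owner cs) (l ! i))"
    using v by (intro aff_le_upper_select_inputs[OF spans x(1)]) (simp add: hidden_neuron_def)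
  then show "y i \<le> real (copy_counts cs l ! i)"
    using num_copies_hidden(2)[OF spans v] i by (simp add: x map relu_def copy_counts_def)
qed

lemma sigma_layers_hidden:
  assumes "spans cs X" "admissible (length cs) X (l # l' # ls)"
  shows "sigma_layers cs (l # l' # ls) =
    concat (map (\<lambda>v. sigma_copies (select_inputs (owner cs) v)) l) #
    sigma_layers (copy_counts cs l) (l' # ls)"
    and "map (\<lambda>v. length (sigma_copies (select_inputs (owner cs) v))) l = copy_counts cs l"
proof -
  have hidden: "hidden_neuron (length cs) X v" if "v \<in> set l" for v
    using assms(2) that by simp
  have "expand_weights cs v = select_inputs (owner cs) v" if "v \<in> set l" for v
    using hidden[OF that] by (simp add: expand_weights_owner hidden_neuron_def)
  then have copies: "map (\<lambda>v. sigma_copies (expand_weights cs v)) l =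
      map (\<lambda>v. sigma_copies (select_inputs (owner cs) v)) l"
    by simp
  show counts: "map (\<lambda>v. length (sigma_copies (select_inputs (owner cs) v))) l = copy_counts cs l"
    unfolding copy_counts_def
    using sigma_copies_eq[OF num_copies_hidden[OF assms(1) hidden]] by simp
  have "map length (map (\<lambda>v. sigma_copies (select_inputs (owner cs) v)) l) = copy_counts cs l"
    unfolding counts[symmetric] by simp
  then show "sigma_layers cs (l # l' # ls) =
    concat (map (\<lambda>v. sigma_copies (select_inputs (owner cs) v)) l) #
    sigma_layers (copy_counts cs l) (l' # ls)"
    unfolding sigma_layers.simps Let_def copies by simp
qed

lemma read_layers_sigma_layers:
  assumes "spans cs X" "admissible (length cs) X ls"
  shows "read_layers (sum_list cs) (map (map node_formula) (sigma_layers cs ls)) = sigma_layers cs ls"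
  using assms
proof (induction cs ls arbitrary: X rule: sigma_layers.induct)
  case (1 cs)
  then show ?case by simp
next
  case (2 cs l)
  have "sigma_neuron (sum_list cs) (node_formula ((expand_weights cs v)\<lparr>act := Sigma\<rparr>)) =
      (expand_weights cs v)\<lparr>act := Sigma\<rparr>" if "v \<in> set l" for v
    using sigma_neuron_output[OF 2(1), of v] 2(2) that
    by (simp add: expand_weights_owner output_neuron_def)
  then show ?case
    by simp
next
  case (3 cs l l' ls)
  note eq = sigma_layers_hidden[OF 3(2,3)]
  have hidden: "hidden_neuron (length cs) X v" if "v \<in> set l" for v
    using 3(3) that by simp
  have counts: "map length (map (\<lambda>v. sigma_copies (expand_weights cs v)) l) = copy_counts cs l"
    unfolding eq(2)[symmetric] using hidden
    by (auto simp: expand_weights_owner hidden_neuron_def)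
  let ?C = "concat (map (\<lambda>v. sigma_copies (select_inputs (owner cs) v)) l)"
  have IH: "read_layers (sum_list (copy_counts cs l))
      (map (map node_formula) (sigma_layers (copy_counts cs l) (l' # ls))) =
      sigma_layers (copy_counts cs l) (l' # ls)"
    using 3(1)[OF refl, of "layer_map l ` X", unfolded counts] spans_layer_map[OF 3(2) hidden] 3(3)
    by (simp add: copy_counts_def)
  have "length ?C = sum_list (copy_counts cs l)"
    unfolding eq(2)[symmetric] by (simp add: length_concat comp_def)
  moreover have "map (sigma_neuron (sum_list cs)) (map node_formula ?C) = ?C"
    unfolding map_map by (rule map_idI) (auto intro: sigma_neuron_copy[OF 3(2) hidden])
  ultimately show ?case
    unfolding eq(1) using IH by (simp only: list.map read_layers.simps length_map)
qed


section \<open>Merging the copies\<close>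

text \<open>The weight with which the function \<open>f\<close> enters the \<open>k\<close>-th node
  of the next level. It is additive over lists, and merging preserves it for every \<open>f\<close>,
  so it can be computed before merging.\<close>

definition total_weight :: "((nat \<Rightarrow> real) \<Rightarrow> real) \<Rightarrow> nat \<Rightarrow> out_neuron list \<Rightarrow> real" where
  "total_weight f k vs = (\<Sum>(v, ws)\<leftarrow>vs. if neuron_map v = f then ws ! k else 0)"

lemma total_weight_simps [simp]:
  "total_weight f k [] = 0"
  "total_weight f k ((v, ws) # vs) = (if neuron_map v = f then ws ! k else 0) + total_weight f k vs"
  "total_weight f k (vs @ vs') = total_weight f k vs + total_weight f k vs'"
  by (simp_all add: total_weight_def)

lemma total_weight_concat:
  "total_weight f k (concat vss) = (\<Sum>vs\<leftarrow>vss. total_weight f k vs)"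
  by (induction vss) auto

lemma total_weight_filter_eq:
  "(\<Sum>(v', ws')\<leftarrow>filter (\<lambda>(v', _). neuron_map v' = f) vs. ws' ! k) = total_weight f k vs"
  by (induction vs) auto

lemma total_weight_filter_neq:
  "f \<noteq> g \<Longrightarrow> total_weight f k (filter (\<lambda>(v', _). neuron_map v' \<noteq> g) vs) = total_weight f k vs"
  by (induction vs) auto

lemma merge_equal:
  assumes "\<forall>(v, ws)\<in>set vs. length ws = m"
  shows "distinct (map (neuron_map \<circ> fst) (merge_equal vs)) \<and>
    (neuron_map \<circ> fst) ` set (merge_equal vs) = (neuron_map \<circ> fst) ` set vs \<and>
    fst ` set (merge_equal vs) \<subseteq> fst ` set vs \<and>
    (\<forall>(v, ws)\<in>set (merge_equal vs). ws = map (\<lambda>k. total_weight (neuron_map v) k vs) [0..<m])"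
  using assms
proof (induction vs rule: merge_equal.induct)
  case 1
  then show ?case by simp
next
  case (2 v ws vs)
  define us where "us = filter (\<lambda>(v', _). neuron_map v' \<noteq> neuron_map v) vs"
  have us: "set us = {u \<in> set vs. neuron_map (fst u) \<noteq> neuron_map v}"
    by (auto simp: us_def)
  have "\<forall>(v, ws)\<in>set us. length ws = m"
    using 2(2) us by auto
  note IH = 2(1)[folded us_def, OF this]
  then have "distinct (map (neuron_map \<circ> fst) (merge_equal us))"
    and maps: "(neuron_map \<circ> fst) ` set (merge_equal us) = (neuron_map \<circ> fst) ` set us"
    and sub: "fst ` set (merge_equal us) \<subseteq> fst ` set us"
    and ws: "\<forall>(v, ws)\<in>set (merge_equal us). ws = map (\<lambda>k. total_weight (neuron_map v) k us) [0..<m]"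
    by blast+
  define w where "w = (v, map (\<lambda>k. ws ! k + total_weight (neuron_map v) k vs) [0..<m])"
  have eq: "merge_equal ((v, ws) # vs) = w # merge_equal us"
    using 2(2) by (simp add: w_def us_def total_weight_filter_eq)
  have ne: "neuron_map v' \<noteq> neuron_map v" if "(v', ws') \<in> set (merge_equal us)" for v' ws'
  proof -
    have "neuron_map v' \<in> (neuron_map \<circ> fst) ` set us"
      using that maps by force
    then show ?thesis
      using us by auto
  qed
  have "neuron_map v \<notin> (neuron_map \<circ> fst) ` set us"
    using us by auto
  then have "distinct (map (neuron_map \<circ> fst) (w # merge_equal us))"
    using \<open>distinct _\<close> maps by (simp add: w_def)
  moreover have "(neuron_map \<circ> fst) ` set (w # merge_equal us) = (neuron_map \<circ> fst) ` set ((v, ws) # vs)"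
    unfolding list.set image_insert maps us by (auto simp: w_def image_iff)
  moreover have "fst ` set (w # merge_equal us) \<subseteq> fst ` set ((v, ws) # vs)"
    using sub us by (auto simp: w_def)
  moreover have "ws'' = map (\<lambda>k. total_weight (neuron_map v') k ((v, ws) # vs)) [0..<m]"
    if "(v', ws'') \<in> set (w # merge_equal us)" for v' ws''
  proof (cases "(v', ws'') = w")
    case False
    then have "(v', ws'') \<in> set (merge_equal us)"
      using that by simp
    from ne[OF this] bspec[OF ws this] show ?thesis
      unfolding us_def by (simp add: total_weight_filter_neq)
  qed (simp add: w_def)
  ultimately show ?case
    unfolding eq by blast
qed

text \<open>Total weights determine an aggregated level up to order: a local map with zero totals
  disappears and one with a nonzero total survives with its totals as outgoing weights. Merging
  keeps one of several nodes with equal map, so the second assumption on \<open>V\<close> is what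
  makes the survivor \<open>V i\<close> itself.\<close>

lemma aggregate_eq:
  fixes V :: "nat \<Rightarrow> neuron" and col :: "nat \<Rightarrow> real list"
  assumes len: "\<forall>(v, ws)\<in>set vs. length ws = m"
    and inj: "inj_on (\<lambda>i. neuron_map (V i)) {..<n}"
    and total: "\<And>f k. k < m \<Longrightarrow>
      total_weight f k vs = (\<Sum>i<n. if neuron_map (V i) = f then col i ! k else 0)"
    and V: "\<And>i. i < n \<Longrightarrow> V i \<in> fst ` set vs"
      "\<And>u i. u \<in> fst ` set vs \<Longrightarrow> i < n \<Longrightarrow> neuron_map u = neuron_map (V i) \<Longrightarrow> u = V i"
    and col: "\<And>i. i < n \<Longrightarrow> length (col i) = m \<and> (\<exists>w\<in>set (col i). w \<noteq> 0)"
  shows "\<exists>p. distinct p \<and> set p = {..<n} \<and> aggregate vs = map (\<lambda>i. (V i, col i)) p"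
proof -
  note merge_all = merge_equal[OF len]
  note merge = conjunct1[OF merge_all] conjunct1[OF conjunct2[OF merge_all]]
  have fst_merge: "v \<in> fst ` set vs" if "(v, ws) \<in> set (merge_equal vs)" for v ws
    using conjunct1[OF conjunct2[OF conjunct2[OF merge_all]]] imageI[OF that, of fst] by auto
  have merge_weights: "ws = map (\<lambda>k. total_weight (neuron_map v) k vs) [0..<m]"
    if "(v, ws) \<in> set (merge_equal vs)" for v ws
    using conjunct2[OF conjunct2[OF conjunct2[OF merge_all]]] that by blast
  define A where "A = aggregate vs"
  have "distinct (map (neuron_map \<circ> fst) A)"
    unfolding A_def aggregate_def by (rule distinct_map_filter) (rule merge(1))
  then have dist: "distinct A" and injA: "inj_on (neuron_map \<circ> fst) (set A)"
    by (simp_all add: distinct_map)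
  have total_col: "map (\<lambda>k. total_weight (neuron_map (V i)) k vs) [0..<m] = col i" if i: "i < n" for i
  proof (rule nth_equalityI)
    fix k assume "k < length (map (\<lambda>k. total_weight (neuron_map (V i)) k vs) [0..<m])"
    then have k: "k < m" by simp
    have "total_weight (neuron_map (V i)) k vs = (\<Sum>i'<n. if i' = i then col i' ! k else 0)"
      unfolding total[OF k] using inj i by (intro sum.cong) (auto dest: inj_onD)
    then show "map (\<lambda>k. total_weight (neuron_map (V i)) k vs) [0..<m] ! k = col i ! k"
      using k i by simp
  qed (use col i in simp)
  have "set A = (\<lambda>i. (V i, col i)) ` {..<n}"
  proof (intro equalityI subsetI)
    fix a assume "a \<in> set A"
    then obtain v ws where a: "a = (v, ws)" "(v, ws) \<in> set (merge_equal vs)" "\<exists>w\<in>set ws. w \<noteq> 0"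
      by (auto simp: A_def aggregate_def)
    have ws: "ws = map (\<lambda>k. total_weight (neuron_map v) k vs) [0..<m]"
      using merge_weights[OF a(2)] .
    then obtain k where k: "k < m" "total_weight (neuron_map v) k vs \<noteq> 0"
      using a(3) by auto
    from k(2) have "(\<Sum>i<n. if neuron_map (V i) = neuron_map v then col i ! k else 0) \<noteq> 0"
      unfolding total[OF k(1)] .
    then obtain i where "i \<in> {..<n}" "(if neuron_map (V i) = neuron_map v then col i ! k else 0) \<noteq> 0"
      by (rule sum.not_neutral_contains_not_neutral)
    then have i: "i < n" "neuron_map (V i) = neuron_map v"
      by (auto split: if_splits)
    have "v \<in> fst ` set vs"
      using fst_merge[OF a(2)] .
    then have "v = V i"
      using V(2) i by simp
    then show "a \<in> (\<lambda>i. (V i, col i)) ` {..<n}"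
      using i ws total_col[OF i(1)] by (simp add: a)
  next
    fix a assume "a \<in> (\<lambda>i. (V i, col i)) ` {..<n}"
    then obtain i where i: "i < n" "a = (V i, col i)"
      by blast
    have "neuron_map (V i) \<in> (neuron_map \<circ> fst) ` set (merge_equal vs)"
      unfolding merge(2) using imageI[OF V(1)[OF i(1)], of neuron_map] by (simp add: image_comp)
    then obtain v ws where v: "(v, ws) \<in> set (merge_equal vs)" "neuron_map v = neuron_map (V i)"
      by force
    have "v \<in> fst ` set vs"
      using fst_merge[OF v(1)] .
    then have "v = V i"
      using V(2) i(1) v(2) by simp
    moreover have "ws = map (\<lambda>k. total_weight (neuron_map v) k vs) [0..<m]"
      using merge_weights[OF v(1)] .
    ultimately have "(v, ws) = a"
      using total_col[OF i(1)] i by simp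
    then show "a \<in> set A"
      using v(1) col[OF i(1)] i by (auto simp: A_def aggregate_def)
  qed
  have injV: "inj_on V {..<n}"
    using inj by (auto simp: inj_on_def)
  \<comment> \<open>The index of each surviving entry is recovered through the inverse of
    \<open>V\<close>, so \<open>p\<close> records the order that merging happens to produce.\<close>
  define p where "p = map (inv_into {..<n} V \<circ> fst) A"
  have inv: "inv_into {..<n} V (fst a) < n \<and> (V (inv_into {..<n} V (fst a)), col (inv_into {..<n} V (fst a))) = a"
    if "a \<in> set A" for a
    using that \<open>set A = _\<close> inv_into_f_f[OF injV] by auto
  have "map (\<lambda>i. (V i, col i)) p = A"
    unfolding p_def map_map comp_def by (rule map_idI) (use inv in blast)
  moreover from this dist have "distinct p"
    using distinct_map[of "\<lambda>i. (V i, col i)" p] by simp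
  moreover have "set p = (\<lambda>i. inv_into {..<n} V (V i)) ` {..<n}"
    by (simp add: p_def \<open>set A = _\<close> image_image)
  then have "set p = {..<n}"
    using inv_into_f_f[OF injV] by simp
  ultimately show ?thesis
    by (intro exI[of _ p]) (simp add: A_def)
qed

text \<open>The companion of each copy cancels against the next copy.\<close>

lemma total_weight_relu_split_copies:
  assumes c: "1 \<le> num_copies v" "upper v = real (num_copies v)" and act: "act v = Relu"
    and k: "k < length ws"
  shows "total_weight f k (concat (map (\<lambda>c. relu_split (c, ws)) (sigma_copies v))) =
    (if neuron_map v = f then ws ! k else 0)"
proof -
  define S where "S = (\<lambda>j. relu_split ((lowered v j)\<lparr>act := Sigma\<rparr>, ws))"
  \<comment> \<open>The part of the shift by \<open>j\<close> in the total for \<open>f\<close>.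
    Every copy but the last contributes \<open>g j - g (Suc j)\<close>.\<close>
  define g where "g = (\<lambda>j. if neuron_map (lowered v j) = f then ws ! k else 0)"
  have up: "upper (lowered v j\<lparr>act := a\<rparr>) = upper v - real j" for j a
    by (simp add: upper_def)
  have relu: "(lowered v j)\<lparr>act := Relu\<rparr> = lowered v j" for j
    using act by (simp add: lowered_def)
  have next_copy: "(lowered v j)\<lparr>bias := bias v - real j - 1, act := Relu\<rparr> = lowered v (Suc j)" for j
    using act by (simp add: lowered_def algebra_simps)
  have S: "total_weight f k (S j) = g j - g (Suc j)" if "Suc j < num_copies v" for j
    using that c k by (simp add: S_def up relu next_copy g_def)
  have tele: "total_weight f k (concat (map S [0..<j])) = g 0 - g j" if "j < num_copies v" for j
    using that by (induction j) (simp_all add: S)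
  obtain n where n: "num_copies v = Suc n"
    using c(1) by (cases "num_copies v") auto
  \<comment> \<open>The last copy has upper bound exactly 1, so \<open>relu_split\<close> adds no
    companion and nothing is left over at the end of the telescope.\<close>
  have "total_weight f k (S n) = g n"
    using c n by (simp add: S_def up relu g_def)
  then have "total_weight f k (concat (map S [0..<num_copies v])) = g 0"
    using tele[of n] by (simp add: n)
  then show ?thesis
    unfolding sigma_copies_eq[OF c] map_map comp_def S_def by (simp add: g_def)
qed

lemma set_relu_split_copies:
  fixes v :: neuron and ws :: "real list"
  assumes c: "1 \<le> num_copies v" "upper v = real (num_copies v)" and act: "act v = Relu"
  defines "B \<equiv> concat (map (\<lambda>c. relu_split (c, ws)) (sigma_copies v))"
  shows "v \<in> fst ` set B"
    and "(u, us) \<in> set B \<Longrightarrow> length us = length ws \<and> weights u = weights v \<and> act u = Relu"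
proof -
  have "(lowered v 0)\<lparr>act := Sigma\<rparr> \<in> set (sigma_copies v)"
    unfolding sigma_copies_eq[OF c] set_map using c(1) by (intro imageI) simp
  then have "set (relu_split ((lowered v 0)\<lparr>act := Sigma\<rparr>, ws)) \<subseteq> set B"
    unfolding B_def set_concat set_map by blast
  moreover have "v \<in> fst ` set (relu_split ((lowered v 0)\<lparr>act := Sigma\<rparr>, ws))"
    using act by auto
  ultimately show "v \<in> fst ` set B"
    by blast
  show "length us = length ws \<and> weights u = weights v \<and> act u = Relu" if "(u, us) \<in> set B"
    using that unfolding B_def sigma_copies_eq[OF c] by (auto split: if_splits)
qed

lemma zip_concat_replicate:
  "length css = length xs \<Longrightarrow> zip (concat css) (concat (map2 replicate (map length css) xs)) =
    concat (map2 (\<lambda>cs x. map (\<lambda>c. (c, x)) cs) css xs)"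
  by (induction css xs rule: list_induct2) (auto simp: zip_replicate2)

text \<open>Copies of one node are consecutive and all inherit its column of outgoing weights, which
  lets the level be treated in blocks, one block per original node.\<close>

lemma with_outgoing_concat:
  "with_outgoing (concat css) (map (select_inputs (owner (map length css))) us) =
    concat (map (\<lambda>i. map (\<lambda>c. (c, map (\<lambda>u. weights u ! i) us)) (css ! i)) [0..<length css])"
proof -
  let ?O = "owner (map length css)"
  define col where "col = (\<lambda>i. map (\<lambda>u. weights u ! i) us)"
  have len: "length ?O = length (concat css)"
    by (simp add: length_owner length_concat)
  have "with_outgoing (concat css) (map (select_inputs ?O) us) =
      map (\<lambda>t. (concat css ! t, col (?O ! t))) [0..<length (concat css)]"
    using len by (simp add: with_outgoing_def col_def)
  also have "\<dots> = map (\<lambda>(c, i). (c, col i)) (zip (concat css) ?O)"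
    using len by (intro nth_equalityI) simp_all
  also have "zip (concat css) ?O = concat (map2 (\<lambda>cs i. map (\<lambda>c. (c, i)) cs) css [0..<length css])"
    by (simp add: owner_def zip_concat_replicate)
  also have "map2 (\<lambda>cs i. map (\<lambda>c. (c, i)) cs) css [0..<length css] =
      map (\<lambda>i. map (\<lambda>c. (c, i)) (css ! i)) [0..<length css]"
    by (intro nth_equalityI) simp_all
  finally show ?thesis
    by (simp add: map_concat comp_def col_def)
qed

text \<open>A nonzero weight rules out the constant nodes, where different biases that are at most 0
  all give the zero map.\<close>

lemma relu_neuron_map_inject:
  fixes v v' :: neuron
  assumes "neuron_map v = neuron_map v'" "act v = Relu" "act v' = Relu"
    and "length (weights v) = length (weights v')" "\<exists>w\<in>set (weights v). w \<noteq> 0"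
  shows "v = v'"
proof -
  obtain i where "i < length (weights v)" "weights v ! i \<noteq> 0"
    using assms(5) by (auto simp: in_set_conv_nth)
  then have "weights v = weights v' \<and> bias v = bias v'"
    using assms(1-4) by (intro relu_aff_inject) (auto simp: neuron_map_def fun_eq_iff)
  then show ?thesis
    using assms(2,3) by simp
qed

text \<open>With zero weights the pre-activation would be the bias everywhere, both positive and at
  most 0.\<close>

lemma hidden_neuron_nonzero_weight:
  assumes "hidden_neuron d X v" "set p = {..<d}"
  shows "\<exists>w\<in>set (weights (select_inputs p v)). w \<noteq> 0"
proof (rule ccontr)
  assume "\<not> ?thesis"
  then have "weights v ! i = 0" if "i < length (weights v)" for i
    using assms that by (auto simp: hidden_neuron_def)
  then have "aff (weights v) (bias v) x = bias v" for x
    by (simp add: aff_def)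
  then show False
    using assms(1) by (auto simp: hidden_neuron_def)
qed

lemma concat_map_concat: "concat (map f (concat xss)) = concat (map (\<lambda>xs. concat (map f xs)) xss)"
  by (induction xss) auto

text \<open>The totals of the block of node \<open>i\<close> telescope to its own outgoing weights,
  attached to its unshifted map. All entries have the weights of some original node, so equal local
  maps mean equal nodes, even across blocks. Inputs are still the copies of the level below, because
  lower levels are converted back later.\<close>

lemma aggregate_copies:
  fixes us :: "neuron list"
  assumes spans: "spans cs X" and hidden: "\<And>v. v \<in> set l \<Longrightarrow> hidden_neuron (length cs) X v"
    and l: "distinct l" and us: "\<And>i. i < length l \<Longrightarrow> \<exists>u\<in>set us. weights u ! i \<noteq> 0"
  defines "vs \<equiv> concat (map relu_split (with_outgoing
      (concat (map (\<lambda>v. sigma_copies (select_inputs (owner cs) v)) l))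
      (map (select_inputs (owner (copy_counts cs l))) us)))"
  shows "\<exists>p. distinct p \<and> set p = {..<length l} \<and>
    aggregate vs = map (\<lambda>i. (select_inputs (owner cs) (l ! i), map (\<lambda>u. weights u ! i) us)) p"
proof -
  define V where "V = (\<lambda>i. select_inputs (owner cs) (l ! i))"
  define col where "col = (\<lambda>i. map (\<lambda>u. weights u ! i) us)"
  define B where "B = (\<lambda>i. concat (map (\<lambda>c. relu_split (c, col i)) (sigma_copies (V i))))"
  have hid: "hidden_neuron (length cs) X (l ! i)" if "i < length l" for i
    using hidden that by simp
  have c: "1 \<le> num_copies (V i)" "upper (V i) = real (num_copies (V i))" if "i < length l" for i
    using num_copies_hidden[OF spans hid[OF that]] by (simp_all add: V_def)
  have act: "act (V i) = Relu" and len: "length (weights (V i)) = sum_list cs"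
    and ne: "\<exists>w\<in>set (weights (V i)). w \<noteq> 0" if "i < length l" for i
    using hid[OF that] hidden_neuron_nonzero_weight[OF hid[OF that] set_owner_spans[OF spans]]
    by (simp_all add: V_def length_owner hidden_neuron_def)
  have "copy_counts cs l = map length (map (\<lambda>v. sigma_copies (select_inputs (owner cs) v)) l)"
    using sigma_copies_eq[OF num_copies_hidden[OF spans hidden]] by (simp add: copy_counts_def)
  then have "with_outgoing
      (concat (map (\<lambda>v. sigma_copies (select_inputs (owner cs) v)) l))
      (map (select_inputs (owner (copy_counts cs l))) us) =
    concat (map (\<lambda>i. map (\<lambda>c. (c, col i)) (map (\<lambda>v. sigma_copies (select_inputs (owner cs) v)) l ! i))
      [0..<length l])"
    using with_outgoing_concat[of "map (\<lambda>v. sigma_copies (select_inputs (owner cs) v)) l" us]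
    by (simp add: col_def)
  also have "\<dots> = concat (map (\<lambda>i. map (\<lambda>c. (c, col i)) (sigma_copies (V i))) [0..<length l])"
    by (intro arg_cong[of _ _ concat] map_cong) (simp_all add: V_def)
  finally have vs: "vs = concat (map B [0..<length l])"
    unfolding vs_def B_def by (simp add: concat_map_concat comp_def)
  have B_mem: "length ws = length us \<and> weights u = weights (V i) \<and> act u = Relu"
    if "i < length l" "(u, ws) \<in> set (B i)" for i u ws
    using set_relu_split_copies(2)[OF c[OF that(1)] act[OF that(1)] that(2)[unfolded B_def]]
    by (simp add: col_def)
  have in_vs: "\<exists>i<length l. (u, ws) \<in> set (B i)" if "(u, ws) \<in> set vs" for u ws
    using that by (auto simp: vs)
  have "\<exists>p. distinct p \<and> set p = {..<length l} \<and> aggregate vs = map (\<lambda>i. (V i, col i)) p"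
  proof (rule aggregate_eq)
    show "\<forall>(u, ws)\<in>set vs. length ws = length us"
    proof clarify
      fix u ws assume "(u, ws) \<in> set vs"
      then obtain i where i: "i < length l" "(u, ws) \<in> set (B i)"
        using in_vs by blast
      then show "length ws = length us"
        using B_mem by blast
    qed
    show "inj_on (\<lambda>i. neuron_map (V i)) {..<length l}"
    proof (rule inj_onI)
      fix i j assume ij: "i \<in> {..<length l}" "j \<in> {..<length l}" "neuron_map (V i) = neuron_map (V j)"
      then have "V i = V j"
        by (intro relu_neuron_map_inject) (simp_all add: act len ne)
      then have "l ! i = l ! j"
        using hid[of i] hid[of j] ij
          select_inputs_inject[OF _ set_owner_spans[OF spans], of "l ! i" "l ! j"]
        by (simp add: hidden_neuron_def V_def)
      then show "i = j"
        using l ij by (simp add: nth_eq_iff_index_eq)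
    qed
    show "total_weight f k vs = (\<Sum>i<length l. if neuron_map (V i) = f then col i ! k else 0)"
      if "k < length us" for f k
    proof -
      have "total_weight f k vs = (\<Sum>i<length l. total_weight f k (B i))"
        by (simp add: vs total_weight_concat comp_def interv_sum_list_conv_sum_set_nat atLeast0LessThan)
      also have "\<dots> = (\<Sum>i<length l. if neuron_map (V i) = f then col i ! k else 0)"
        unfolding B_def using c act that
        by (intro sum.cong total_weight_relu_split_copies) (simp_all add: col_def)
      finally show ?thesis .
    qed
    show "V i \<in> fst ` set vs" if "i < length l" for i
    proof -
      have "set (B i) \<subseteq> set vs"
        using that by (auto simp: vs)
      moreover have "V i \<in> fst ` set (B i)"
        unfolding B_def by (rule set_relu_split_copies(1)[OF c[OF that] act[OF that]])
      ultimately show ?thesis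
        by blast
    qed
    show "u = V i" if u: "u \<in> fst ` set vs" and "i < length l" "neuron_map u = neuron_map (V i)" for u i
    proof -
      obtain ws where "(u, ws) \<in> set vs"
        using u by auto
      then obtain j where j: "j < length l" "(u, ws) \<in> set (B j)"
        using in_vs by blast
      then have "weights u = weights (V j) \<and> act u = Relu"
        using B_mem by blast
      then show ?thesis
        using j(1) that by (intro relu_neuron_map_inject) (simp_all add: act len ne)
    qed
    show "length (col i) = length us \<and> (\<exists>w\<in>set (col i). w \<noteq> 0)" if "i < length l" for i
      using us[OF that] by (auto simp: col_def)
  qed
  then show ?thesis
    by (simp add: V_def col_def)
qed

section \<open>Networks with reordered levels\<close>

fun permute_layers :: "nat list \<Rightarrow> neuron list list \<Rightarrow> nat list list \<Rightarrow> neuron list list" where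
  "permute_layers p (l # ls) (q # qs) =
     map (\<lambda>i. select_inputs p (l ! i)) q # permute_layers q ls qs"
| "permute_layers p _ _ = []"

definition orders :: "neuron list list \<Rightarrow> nat list list \<Rightarrow> bool" where
  "orders = list_all2 (\<lambda>l q. distinct q \<and> set q = {..<length l})"

text \<open>The output node keeps the activation \<sigma> until \<open>finish_output\<close>, so
  before that step the networks differ from the original in this activation as well as in the order
  of nodes.\<close>

fun set_output_act :: "activation \<Rightarrow> neuron list list \<Rightarrow> neuron list list" where
  "set_output_act a [] = []"
| "set_output_act a [l] = [map (\<lambda>v. v\<lparr>act := a\<rparr>) l]"
| "set_output_act a (l # l' # ls) = l # set_output_act a (l' # ls)"

lemma with_outgoing_cong:
  assumes "map weights nx = map weights nx'"
  shows "with_outgoing l nx = with_outgoing l nx'"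
proof -
  have "map (\<lambda>u. weights u ! i) nx = map (\<lambda>u. weights u ! i) nx'" for i
    using arg_cong[OF assms, of "map (\<lambda>ws. ws ! i)"] by (simp add: comp_def)
  then show ?thesis
    by (simp add: with_outgoing_def)
qed

lemma weights_hd_set_output_act:
  "map weights (hd (set_output_act a (nx # R))) = map weights nx"
  by (cases R) simp_all

lemma set_incoming_set_output_act:
  "set_incoming vs (hd (set_output_act a (nx # R))) # tl (set_output_act a (nx # R)) =
    set_output_act a (set_incoming vs nx # R)"
  by (cases R) (simp_all add: set_incoming_def)

lemma set_incoming_select_inputs:
  "set_incoming (map (\<lambda>i. (V i, map (\<lambda>u. weights u ! i) us)) p) (map (select_inputs q) us) =
    map (select_inputs p) us"
  by (intro nth_equalityI) (simp_all add: set_incoming_def select_inputs_def comp_def)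

text \<open>Conversion starts at the top, so the levels in \<open>ls\<close> are already restored
  while the first of them still reads from the copies below; hence \<open>owner cs\<close> as its
  input selection. Aggregating the level below later replaces that selection by an order
  \<open>p\<close>.\<close>

lemma relu_layers_sigma_layers:
  assumes "spans cs X" "admissible (length cs) X ls"
  shows "\<exists>qs. orders ls qs \<and>
    relu_layers (sigma_layers cs ls) = set_output_act Sigma (permute_layers (owner cs) ls qs)"
  using assms
proof (induction cs ls arbitrary: X rule: sigma_layers.induct)
  case (1 cs)
  then show ?case by simp
next
  case (2 cs l)
  have "expand_weights cs v = select_inputs (owner cs) v" if "v \<in> set l" for v
    using 2(2) that by (simp add: expand_weights_owner output_neuron_def)
  moreover have "map (\<lambda>i. f (l ! i)) [0..<length l] = map f l" for f :: "neuron \<Rightarrow> neuron"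
    by (rule nth_equalityI) simp_all
  ultimately show ?case
    by (intro exI[of _ "[[0..<length l]]"]) (simp add: orders_def atLeast0LessThan comp_def)
next
  case (3 cs l l' ls)
  let ?O = "owner (copy_counts cs l)"
  note eq = sigma_layers_hidden[OF 3(2,3)]
  have hidden: "hidden_neuron (length cs) X v" if "v \<in> set l" for v
    using 3(3) that by simp
  have counts: "map length (map (\<lambda>v. sigma_copies (expand_weights cs v)) l) = copy_counts cs l"
    unfolding eq(2)[symmetric] using hidden
    by (auto simp: expand_weights_owner hidden_neuron_def)
  have "\<exists>qs. orders (l' # ls) qs \<and> relu_layers (sigma_layers (copy_counts cs l) (l' # ls)) =
      set_output_act Sigma (permute_layers ?O (l' # ls) qs)"
    using 3(1)[OF refl, of "layer_map l ` X", unfolded counts] spans_layer_map[OF 3(2) hidden] 3(3)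
    by (simp add: copy_counts_def)
  then obtain q qs where q: "distinct q" "set q = {..<length l'}" "orders ls qs"
    and above: "relu_layers (sigma_layers (copy_counts cs l) (l' # ls)) =
      set_output_act Sigma (permute_layers ?O (l' # ls) (q # qs))"
    by (auto simp: orders_def list_all2_Cons1)
  define us where "us = map (\<lambda>i. l' ! i) q"
  define R where "R = permute_layers q ls qs"
  define C where "C = concat (map (\<lambda>v. sigma_copies (select_inputs (owner cs) v)) l)"
  define vs where "vs = aggregate (concat (map relu_split (with_outgoing C (map (select_inputs ?O) us))))"
  have "set us = set l'"
    unfolding us_def set_map q(2) by (auto simp: in_set_conv_nth)
  then have "\<exists>u\<in>set us. weights u ! i \<noteq> 0" if "i < length l" for i
    using 3(3) that by simp
  then obtain p where p: "distinct p" "set p = {..<length l}"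
    and vs: "vs = map (\<lambda>i. (select_inputs (owner cs) (l ! i), map (\<lambda>u. weights u ! i) us)) p"
    unfolding vs_def C_def using aggregate_copies[OF 3(2) hidden, of l us] 3(3) by auto
  have above': "relu_layers (sigma_layers (copy_counts cs l) (l' # ls)) =
      set_output_act Sigma (map (select_inputs ?O) us # R)"
    unfolding above by (simp add: us_def R_def comp_def)
  \<comment> \<open>Outgoing weights are read off the weights of the level above alone, so it does
    not matter whether that level is the output level with its activation \<sigma>.\<close>
  have wo: "with_outgoing C (hd (set_output_act Sigma (map (select_inputs ?O) us # R))) =
      with_outgoing C (map (select_inputs ?O) us)"
    by (intro with_outgoing_cong weights_hd_set_output_act)
  \<comment> \<open>Exposes a second level, so that the recursive equation of
    \<open>relu_layers\<close> applies.\<close>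
  obtain l'' ls'' where S: "sigma_layers (copy_counts cs l) (l' # ls) = l'' # ls''"
    by (cases ls) (auto simp: Let_def)
  have "relu_layers (sigma_layers cs (l # l' # ls)) =
      map fst vs # set_output_act Sigma (set_incoming vs (map (select_inputs ?O) us) # R)"
    unfolding eq(1) S relu_layers.simps Let_def above'[unfolded S] C_def[symmetric] wo vs_def[symmetric]
      set_incoming_set_output_act ..
  also have "set_incoming vs (map (select_inputs ?O) us) = map (select_inputs p) us"
    unfolding vs by (rule set_incoming_select_inputs)
  also have "map fst vs # set_output_act Sigma (map (select_inputs p) us # R) =
      set_output_act Sigma (permute_layers (owner cs) (l # l' # ls) (p # q # qs))"
    by (simp add: vs us_def R_def comp_def)
  finally have "relu_layers (sigma_layers cs (l # l' # ls)) =
      set_output_act Sigma (permute_layers (owner cs) (l # l' # ls) (p # q # qs))" .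
  moreover have "orders (l # l' # ls) (p # q # qs)"
    using p q by (simp add: orders_def)
  ultimately show ?case
    by blast
qed

lemma set_output_act_idem:
  "orders ls qs \<Longrightarrow> ls \<noteq> [] \<Longrightarrow> \<forall>v\<in>set (last ls). act v = a \<Longrightarrow>
    set_output_act a (permute_layers p ls qs) = permute_layers p ls qs"
proof (induction p ls qs rule: permute_layers.induct)
  case (1 p l ls q qs)
  show ?case
  proof (cases ls)
    case Nil
    have "(select_inputs p (l ! i))\<lparr>act := a\<rparr> = select_inputs p (l ! i)" if "i \<in> set q" for i
      using 1(2,4) that Nil by (simp add: orders_def select_inputs_def)
    then show ?thesis
      using Nil 1(2) by (simp add: orders_def)
  next
    case (Cons l' ls')
    then obtain q' qs' where "qs = q' # qs'"
      using 1(2) by (auto simp: orders_def list_all2_Cons1)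
    then show ?thesis
      using 1 Cons by (simp add: orders_def)
  qed
qed (simp_all add: orders_def)

lemma set_output_act_eq:
  assumes "R \<noteq> []" "length (last R) = 1"
  shows "butlast (set_output_act a R) @ [[(hd (last (set_output_act a R)))\<lparr>act := a'\<rparr>]] =
    set_output_act a' R"
  using assms
proof (induction R rule: induct_list012)
  case (2 l)
  then obtain v where "l = [v]"
    by (auto simp: length_Suc_conv)
  then show ?case by simp
next
  case (3 l l' R)
  have "set_output_act a (l' # R) \<noteq> []"
    by (cases R) auto
  then show ?case
    using 3 by simp
qed simp

text \<open>Reordering a level only reindexes the sums of the next one. The realization is needed
  because \<open>finish_output\<close> decides by its range. The vectors \<open>x\<close> and
  \<open>y\<close> are related through the pre-activations they produce, which is the form in which
  the relation passes from level to level.\<close>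

lemma feed_permute_layers:
  assumes "admissible d X ls" "orders ls qs"
    and "\<And>v. length (weights v) = d \<Longrightarrow>
      aff (weights (select_inputs p v)) (bias v) y = aff (weights v) (bias v) x"
    and "i < length (last qs)"
  shows "feed (permute_layers p ls qs) y i = feed ls x (last qs ! i)"
  using assms
proof (induction ls arbitrary: d X p qs x y)
  case Nil
  then show ?case by simp
next
  case (Cons l ls)
  obtain q qs' where qs: "qs = q # qs'" "distinct q" "set q = {..<length l}" "orders ls qs'"
    using Cons(3) by (auto simp: orders_def list_all2_Cons1)
  have map: "neuron_map (select_inputs p v) y = neuron_map v x" if "v \<in> set l" for v
    using Cons(4)[OF admissible_length_weights[OF Cons(2) that]] by (simp add: neuron_map_def)
  define y' where "y' = layer_map (map (\<lambda>i. select_inputs p (l ! i)) q) y"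
  have y': "y' t = layer_map l x (q ! t)" if "t < length q" for t
  proof -
    have "q ! t < length l"
      using that nth_mem[OF that] qs(3) by auto
    then show ?thesis
      using that by (simp add: y'_def layer_map_def map)
  qed
  have eq: "feed (permute_layers p (l # ls) qs) y = feed (permute_layers q ls qs') y'"
    "feed (l # ls) x = feed ls (layer_map l x)"
    by (simp_all add: qs y'_def layer_map_def)
  show ?case
  proof (cases ls)
    case Nil
    with qs have "qs' = []"
      by (simp add: orders_def)
    then show ?thesis
      unfolding eq using Nil y' Cons(5) qs by simp
  next
    case (Cons l' ls')
    have aff: "aff (weights (select_inputs q v)) (bias v) y' = aff (weights v) (bias v) (layer_map l x)"
      if "length (weights v) = length l" for v
    proof -
      have "(\<Sum>t<length q. weights v ! (q ! t) * layer_map l x (q ! t)) =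
          (\<Sum>t<length l. weights v ! t * layer_map l x t)"
        using bij_betw_nth[OF qs(2) refl qs(3)[symmetric]]
        by (intro sum.reindex_bij_betw)
      then show ?thesis
        using that y' by (simp add: aff_def)
    qed
    have "qs' \<noteq> []"
      using Cons qs(4) by (auto simp: orders_def)
    then have "i < length (last qs')" "last qs = last qs'"
      using Cons.prems(4) qs(1) by simp_all
    moreover have "admissible (length l) (layer_map l ` X) ls"
      using Cons.prems(1) Cons by simp
    ultimately show ?thesis
      unfolding eq using Cons.IH[OF _ qs(4) aff] by simp
  qed
qed

lemma permute_layers_nth:
  "length qs = length ls \<Longrightarrow> j < length ls \<Longrightarrow>
    permute_layers p ls qs ! j = map (\<lambda>i. select_inputs ((p # qs) ! j) (ls ! j ! i)) (qs ! j)"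
  by (induction p ls qs arbitrary: j rule: permute_layers.induct) (auto simp: nth_Cons split: nat.splits)

lemma length_permute_layers: "length qs = length ls \<Longrightarrow> length (permute_layers p ls qs) = length ls"
  by (induction p ls qs rule: permute_layers.induct) auto


section \<open>Non-degenerate networks\<close>

lemma feed_append: "feed (ls @ ls') x = feed ls' (feed ls x)"
  by (induction ls arbitrary: x) simp_all

lemma feed_take_Suc:
  assumes "k < length ls"
  shows "feed (take (Suc k) ls) x = layer_map (ls ! k) (feed (take k ls) x)"
  unfolding take_Suc_conv_app_nth[OF assms] feed_append by (simp add: layer_map_def)

lemma width_Suc: "k < depth N \<Longrightarrow> width N (Suc k) = length (layers N ! k)"
  by (simp add: width_def widths_def depth_def)

lemma width_0: "width N 0 = inputs N"
  by (simp add: width_def widths_def)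

lemma node_Suc: "node N (Suc k) i = layers N ! k ! i"
  by (simp add: node_def)

lemma nondegenerate_class_layers:
  assumes "N \<in> nondegenerate_class n"
  shows "layers N \<noteq> []" "length (last (layers N)) = 1" "inputs N = n"
proof -
  have "architecture (widths N)"
    using assms by (simp add: nondegenerate_class_def relu_network_def layered_def)
  then show "layers N \<noteq> []"
    by (auto simp: architecture_def widths_def)
  with \<open>architecture (widths N)\<close> show "length (last (layers N)) = 1"
    by (simp add: architecture_def widths_def last_map)
  show "inputs N = n"
    using assms by (simp add: nondegenerate_class_def)
qed

lemma nondegenerate_class_node:
  assumes "N \<in> nondegenerate_class n" "k < depth N" "v \<in> set (layers N ! k)"
  shows "length (weights v) = width N k" "set (weights v) \<subseteq> \<int>" "bias v \<in> \<int>"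
proof -
  obtain i where i: "i < width N (Suc k)" "v = node N (Suc k) i"
    using assms(2,3) by (auto simp: in_set_conv_nth width_Suc node_Suc)
  have k: "Suc k \<in> {1..depth N}"
    using assms(2) by simp
  have "layered N" "integer_network N"
    using assms(1) by (simp_all add: nondegenerate_class_def relu_network_def)
  then have "length (weights (node N (Suc k) i)) = width N (Suc k - 1)"
    "set (weights (node N (Suc k) i)) \<subseteq> \<int> \<and> bias (node N (Suc k) i) \<in> \<int>"
    using k i(1) unfolding layered_def integer_network_def by blast+
  then show "length (weights v) = width N k" "set (weights v) \<subseteq> \<int>" "bias v \<in> \<int>"
    by (simp_all add: i)
qed

text \<open>Entry \<open>k\<close> of \<open>layers\<close> is level \<open>Suc k\<close>, so
  \<open>Suc k < depth N\<close> selects the hidden levels, and the values entering the node are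
  those after the first \<open>k\<close> levels.\<close>

lemma nondegenerate_class_hidden:
  assumes N: "N \<in> nondegenerate_class n" and k: "Suc k < depth N" and v: "v \<in> set (layers N ! k)"
  shows "hidden_neuron (width N k) (feed (take k (layers N)) ` unit_cube n) v"
proof -
  obtain i where i: "i < width N (Suc k)" "v = node N (Suc k) i"
    using k v by (auto simp: in_set_conv_nth width_Suc node_Suc)
  have j: "Suc k \<in> {1..<depth N}"
    using k by simp
  have act: "act v = Relu"
    using N j i by (auto simp: nondegenerate_class_def relu_network_def)
  have map: "global_map N (Suc k) i x = relu (aff (weights v) (bias v) (feed (take k (layers N)) x))" for x
    using k i act
    by (simp add: global_map_def feed_take_Suc depth_def layer_map_def width_Suc node_Suc neuron_map_def)
  have nd: "nondegenerate N" "inputs N = n"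
    using N by (simp_all add: nondegenerate_class_def)
  then obtain x y where "x \<in> unit_cube n" "global_map N (Suc k) i x > 0"
    "y \<in> unit_cube n" "global_map N (Suc k) i y = 0"
    using j i(1) unfolding nondegenerate_def by metis
  then have "\<exists>x\<in>unit_cube n. aff (weights v) (bias v) (feed (take k (layers N)) x) > 0"
    "\<exists>x\<in>unit_cube n. aff (weights v) (bias v) (feed (take k (layers N)) x) \<le> 0"
    unfolding map by (force simp: relu_def max_def split: if_splits)+
  then show ?thesis
    using nondegenerate_class_node[OF N _ v] k act by (auto simp: hidden_neuron_def)
qed

lemma nondegenerate_class_output:
  assumes N: "N \<in> nondegenerate_class n" and k: "Suc k = depth N" and v: "v \<in> set (layers N ! k)"
  shows "act v = Ident" "output_neuron (width N k) (feed (take k (layers N)) ` unit_cube n) v"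
proof -
  have "layers N ! k = last (layers N)"
    using nondegenerate_class_layers(1)[OF N] by (simp add: last_conv_nth flip: k[unfolded depth_def])
  then have len: "length (layers N ! k) = 1"
    using nondegenerate_class_layers(2)[OF N] by simp
  then have v_eq: "v = layers N ! k ! 0"
    using v by (auto simp: length_Suc_conv)
  then show act: "act v = Ident"
    using N k by (auto simp: nondegenerate_class_def relu_network_def simp flip: node_Suc)
  have "realization N x = aff (weights v) (bias v) (feed (take k (layers N)) x)" for x
    using k act len v_eq feed_take_Suc[of k "layers N" x]
    by (simp add: realization_def global_map_def depth_def layer_map_def neuron_map_def)
  then have "\<forall>x\<in>unit_cube n. aff (weights v) (bias v) (feed (take k (layers N)) x) \<in> {0..1}"
    using N by (force simp: nondegenerate_class_def)
  then show "output_neuron (width N k) (feed (take k (layers N)) ` unit_cube n) v"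
    using nondegenerate_class_node[OF N _ v] k by (simp add: output_neuron_def)
qed

lemma nondegenerate_class_distinct:
  assumes N: "N \<in> nondegenerate_class n" and k: "k < depth N"
  shows "distinct (layers N ! k)"
  unfolding distinct_conv_nth
proof (intro allI impI)
  fix i j assume ij: "i < length (layers N ! k)" "j < length (layers N ! k)" "i \<noteq> j"
  have "nondegenerate N"
    using N by (simp add: nondegenerate_class_def)
  moreover have "Suc k \<in> {0..depth N}"
    using k by simp
  ultimately have "local_map N (Suc k) i \<noteq> local_map N (Suc k) j"
    using ij unfolding nondegenerate_def width_Suc[OF k, symmetric] by blast
  then show "layers N ! k ! i \<noteq> layers N ! k ! j"
    by (auto simp: local_map_def node_Suc)
qed

text \<open>The induction descends from the output level, since \<open>admissible\<close> for a
  level refers to the levels above it.\<close>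

lemma nondegenerate_class_admissible_drop:
  assumes N: "N \<in> nondegenerate_class n" and "k \<le> depth N - 1"
  shows "admissible (width N k) (feed (take k (layers N)) ` unit_cube n) (drop k (layers N))"
  using assms(2)
proof (induction k rule: inc_induct)
  case base
  have "depth N > 0"
    using nondegenerate_class_layers(1)[OF N] by (simp add: depth_def)
  then have k: "Suc (depth N - 1) = depth N"
    by simp
  then have "drop (depth N - 1) (layers N) = [layers N ! (depth N - 1)]"
    by (metis Cons_nth_drop_Suc depth_def drop_all lessI order_refl)
  then show ?case
    using nondegenerate_class_output(2)[OF N k] by simp
next
  case (step k)
  then have k: "Suc k < depth N"
    by simp
  then have drop: "drop k (layers N) = layers N ! k # layers N ! Suc k # drop (Suc (Suc k)) (layers N)"
    "drop (Suc k) (layers N) = layers N ! Suc k # drop (Suc (Suc k)) (layers N)"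
    by (simp_all add: depth_def Cons_nth_drop_Suc)
  have image: "layer_map (layers N ! k) ` feed (take k (layers N)) ` unit_cube n =
      feed (take (Suc k) (layers N)) ` unit_cube n"
    using k by (simp add: feed_take_Suc depth_def image_image)
  have "nondegenerate N" "Suc k \<in> {1..<depth N}"
    using N k by (simp_all add: nondegenerate_class_def)
  then have "\<exists>m<width N (Suc k + 1). weights (node N (Suc k + 1) m) ! i \<noteq> 0"
    if "i < width N (Suc k)" for i
    using that unfolding nondegenerate_def by blast
  then have "\<exists>u\<in>set (layers N ! Suc k). weights u ! i \<noteq> 0" if "i < length (layers N ! k)" for i
    using that k by (fastforce simp: width_Suc node_Suc)
  then show ?case
    using step.IH nondegenerate_class_distinct[OF N] nondegenerate_class_hidden[OF N k] k
    unfolding drop admissible.simps image by (simp add: width_Suc)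
qed

text \<open>The start of the level induction: each input node counts as its own single copy.\<close>

lemma spans_unit_cube: "spans (replicate n 1) (unit_cube n)"
  unfolding spans_def
proof (intro conjI allI impI ballI)
  show "\<exists>x\<in>unit_cube n. x i = 0" "\<exists>x\<in>unit_cube n. x i > 0" for i
    by (auto simp: unit_cube_def intro: exI[of _ "\<lambda>_. 0"] exI[of _ "\<lambda>_. 1"])
qed (use zero_in_unit_cube in \<open>auto simp: unit_cube_def\<close>)

text \<open>Reordering leaves the realization unchanged, and that of \<open>N\<close> has values in
  [0, 1] on the cube. The range test therefore succeeds, and the activation is dropped without
  adding a level.\<close>

lemma finish_output_permute_layers:
  fixes N :: network
  assumes N: "N \<in> nondegenerate_class n" and qs: "orders (layers N) qs"
  shows "finish_output \<lparr>inputs = n, layers = set_output_act Sigma (permute_layers [0..<n] (layers N) qs)\<rparr> =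
    \<lparr>inputs = n, layers = permute_layers [0..<n] (layers N) qs\<rparr>"
    and "last qs = [0]"
proof -
  define R where "R = permute_layers [0..<n] (layers N) qs"
  have len: "length qs = length (layers N)"
    using qs by (simp add: orders_def list_all2_lengthD)
  note ne = nondegenerate_class_layers[OF N]
  define k where "k = depth N - 1"
  have k: "Suc k = depth N" "k < length (layers N)" "k < length qs"
    using ne(1) len by (simp_all add: k_def depth_def)
  have qs_ne: "qs \<noteq> []"
    using ne(1) len by auto
  have last: "last (layers N) = layers N ! k" "last qs = qs ! k"
    using ne(1) qs_ne len by (simp_all add: last_conv_nth k_def depth_def)
  have "distinct (qs ! k)" "set (qs ! k) = {0}"
    using qs k ne(2) last by (auto simp: orders_def list_all2_conv_all_nth lessThan_Suc)
  moreover from this have "length (qs ! k) = 1"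
    using distinct_card[of "qs ! k"] by simp
  then obtain i where "qs ! k = [i]"
    by (auto simp: length_Suc_conv)
  ultimately show last_qs: "last qs = [0]"
    unfolding last by simp
  have lenR: "length R = length (layers N)"
    using len by (simp add: R_def length_permute_layers)
  then have "R \<noteq> []"
    using ne(1) by auto
  moreover have "last R = R ! k"
    using lenR \<open>R \<noteq> []\<close> by (simp add: last_conv_nth k_def depth_def)
  then have "length (last R) = 1"
    using last_qs last k len by (simp add: R_def permute_layers_nth)
  ultimately have "butlast (set_output_act Sigma R) @
      [[(hd (last (set_output_act Sigma R)))\<lparr>act := Ident\<rparr>]] = set_output_act Ident R"
    by (rule set_output_act_eq)
  also have "\<dots> = R"
    unfolding R_def using ne(1) nondegenerate_class_output(1)[OF N k(1)] last
    by (intro set_output_act_idem[OF qs]) simp_all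
  finally have R: "butlast (set_output_act Sigma R) @
      [[(hd (last (set_output_act Sigma R)))\<lparr>act := Ident\<rparr>]] = R" .
  have adm: "admissible n (unit_cube n) (layers N)"
    using nondegenerate_class_admissible_drop[OF N, of 0] ne(3) by (simp add: width_0)
  have "feed R x 0 = feed (layers N) x (last qs ! 0)" for x
    unfolding R_def
  proof (rule feed_permute_layers[OF adm qs])
    fix v :: neuron assume "length (weights v) = n"
    then show "aff (weights (select_inputs [0..<n] v)) (bias v) x = aff (weights v) (bias v) x"
      by (simp add: aff_def)
  qed (simp add: last_qs)
  then have "realization \<lparr>inputs = n, layers = R\<rparr> x = realization N x" for x
    by (simp add: realization_def global_map_def depth_def last_qs)
  then have "\<forall>x\<in>unit_cube n. 0 \<le> realization \<lparr>inputs = n, layers = R\<rparr> x \<and>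
      realization \<lparr>inputs = n, layers = R\<rparr> x \<le> 1"
    using N by (force simp: nondegenerate_class_def)
  then show "finish_output \<lparr>inputs = n, layers = set_output_act Sigma (permute_layers [0..<n] (layers N) qs)\<rparr> =
    \<lparr>inputs = n, layers = permute_layers [0..<n] (layers N) qs\<rparr>"
    unfolding R_def[symmetric] finish_output_def Let_def by (simp add: R)
qed

text \<open>The lists of orders are themselves the matching: position \<open>i\<close> of level
  \<open>j\<close> holds the original node \<open>ps ! j ! i\<close>. The identity order is
  prepended for the inputs, and the singleton order \<open>[0]\<close> fixes the output.\<close>

lemma same_network_permute_layers:
  fixes N :: network
  assumes N: "N \<in> nondegenerate_class n" and qs: "orders (layers N) qs" and last: "last qs = [0]"
  shows "same_network \<lparr>inputs = n, layers = permute_layers [0..<n] (layers N) qs\<rparr> N"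
proof -
  define M where "M = \<lparr>inputs = n, layers = permute_layers [0..<n] (layers N) qs\<rparr>"
  define ps where "ps = [0..<n] # qs"
  have len: "length qs = depth N"
    using qs by (simp add: orders_def list_all2_lengthD depth_def)
  note ne = nondegenerate_class_layers[OF N]
  have depth: "depth M = depth N"
    using len by (simp add: M_def depth_def length_permute_layers)
  have layers: "layers M ! k = map (\<lambda>i. select_inputs (ps ! k) (layers N ! k ! i)) (ps ! Suc k)"
    if "k < depth N" for k
    using that len by (simp add: M_def ps_def permute_layers_nth depth_def)
  have width: "width M j = length (ps ! j)" if "j \<le> depth N" for j
    using that layers depth by (cases j) (simp_all add: width_0 width_Suc M_def ps_def)
  have ps: "distinct (ps ! j) \<and> set (ps ! j) = {..<width N j}" if "j \<le> depth N" for j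
  proof (cases j)
    case 0
    then show ?thesis
      by (simp add: ps_def width_0 ne(3) atLeast0LessThan)
  next
    case (Suc k)
    then show ?thesis
      using that qs by (simp add: ps_def width_Suc orders_def list_all2_conv_all_nth depth_def)
  qed
  have "bij_betw (\<lambda>i. ps ! j ! i) {..<width M j} {..<width N j}" if "j \<le> depth N" for j
    using ps[OF that] width[OF that] by (intro bij_betw_nth) simp_all
  moreover have "ps ! j ! i = i" if "j \<in> {0, depth N}" "i < width M j" for i j
  proof (cases "j = 0")
    case True
    then show ?thesis
      using that(2) width[of 0] by (simp add: ps_def)
  next
    case False
    have "qs \<noteq> []"
      using len ne(1) by (auto simp: depth_def)
    then have "ps ! depth N = [0]"
      using last len \<open>qs \<noteq> []\<close> False that(1) by (simp add: ps_def last_conv_nth nth_Cons')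
    then show ?thesis
      using that False width[of "depth N"] by simp
  qed
  moreover have "let v = node M j i; v' = node N j (ps ! j ! i) in
      act v' = act v \<and> bias v' = bias v \<and>
      length (weights v) = width M (j - 1) \<and> length (weights v') = width N (j - 1) \<and>
      (\<forall>i'<width M (j - 1). weights v' ! (ps ! (j - 1) ! i') = weights v ! i')"
    if j: "j \<in> {1..depth N}" and i: "i < width M j" for j i
  proof -
    obtain k where k: "j = Suc k" "k < depth N"
      using j by (cases j) auto
    have i': "i < length (ps ! Suc k)"
      using i width[of j] k by simp
    have v: "node M j i = select_inputs (ps ! k) (node N j (ps ! j ! i))"
      using k i' by (simp add: node_Suc layers)
    have "ps ! Suc k ! i \<in> set (ps ! Suc k)"
      using i' by (rule nth_mem)
    then have "ps ! Suc k ! i < length (layers N ! k)"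
      using ps[of "Suc k"] k by (simp add: width_Suc)
    then have "length (weights (node N j (ps ! j ! i))) = width N k"
      using nondegenerate_class_node(1)[OF N k(2)] k by (simp add: node_Suc)
    then show ?thesis
      using k width[of k] by (simp add: Let_def v[unfolded k(1)])
  qed
  ultimately show ?thesis
    unfolding M_def[symmetric] same_network_def depth
    using ne(3) by (intro conjI exI[of _ "\<lambda>j i. ps ! j ! i"]) (simp_all add: M_def)
qed

theorem proposition5:
  fixes n :: nat and N :: network
  assumes "N \<in> nondegenerate_class n"
  shows "same_network (constr (ext N)) N"
proof -
  let ?cs = "replicate n (1 :: nat)"
  have inputs: "inputs N = n"
    using nondegenerate_class_layers(3)[OF assms] .
  have adm: "admissible (length ?cs) (unit_cube n) (layers N)"
    using nondegenerate_class_admissible_drop[OF assms, of 0] by (simp add: width_0 inputs)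
  obtain qs where qs: "orders (layers N) qs"
    and relu: "relu_layers (sigma_layers ?cs (layers N)) =
      set_output_act Sigma (permute_layers (owner ?cs) (layers N) qs)"
    using relu_layers_sigma_layers[OF spans_unit_cube adm] by blast
  have "read_layers n (formulae (ext N)) = sigma_layers ?cs (layers N)"
    using read_layers_sigma_layers[OF spans_unit_cube adm]
    by (simp add: ext_def inputs sum_list_replicate)
  then have "constr (ext N) = finish_output
      \<lparr>inputs = n, layers = set_output_act Sigma (permute_layers [0..<n] (layers N) qs)\<rparr>"
    using relu[unfolded owner_replicate_1] by (simp add: constr_def) (simp add: ext_def inputs)
  then show ?thesis
    using finish_output_permute_layers[OF assms qs]
      same_network_permute_layers[OF assms qs] by simp
qed

end
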